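(* Let $f:[0,1]\to[0,1]$ be a unimodal map with critical point $c$, let $q$ be its orientation-reversing fixed point, put $I^1=(\hat q,q)$, and let $\{I^k\}_{k\ge 1}$ be the principal nest of $f$ starting from $I^1$. Let $S_0=1$, $S_1=2$, $S_{k+1}=S_k+S_{k-1}$ be the Fibonacci numbers. Consider the following three properties, for every $k\ge 1$: (1) $I^k\cap D(I^k)$ has exactly two connected components that intersect $\mathrm{orb}^+(c)$, denoted $I_0^k$ and $I_1^k$, where $I_0^k=I^{k+1}$; (2) $R_{I^k}|_{I_0^k}=f^{S_{k+1}}$ and $R_{I^k}|_{I_1^k}=f^{S_k}$; (3) $f^{S_k}(c)\notin I^k$. If $f$ is a Fibonacci map, then $f$ satisfies (1), (2) and (3). Conversely, if $f$ satisfies (1), (2) and (3), then $f$ is a Fibonacci map.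
   Context: A unimodal map $f:[0,1]\to[0,1]$ is a continuous map with a unique critical point $c\in(0,1)$ such that $f$ is increasing to the left of $c$ and decreasing to the right of $c$. Throughout, $f(0)=f(1)=0$ and $f$ is symmetric about $c$: writing $\hat x$ for the point symmetric to $x$ with respect to $c$ (so $\hat x\ne x$ for $x\neq c$), one has $f(\hat x)=f(x)$. Intervals are written $(a,b)$ for the open interval with endpoints $a,b$, irrespective of their order. The orientation-reversing fixed point $q$ is the fixed point of $f$ in $(c,1)$. The forward critical orbit is $\mathrm{orb}^+(c)=\{f^k(c):k\ge 0\}$. Fibonacci map: for $k\ge 0$ let $c_{-k}\in f^{-k}(c)$ be a point of $f^{-k}(c)$ nearest to $c$. Let $T_0=1$ and inductively $T_i=\min\{k\ge T_{i-1}: c_{-k}\in (c_{-T_{i-1}},\hat c_{-T_{i-1}})\}$. The map $f$ is called a Fibonacci map if $T_i=S_i$ for all $i\geq 0$, where $S_0=1$, $S_1=2$, $S_{k+1}=S_k+S_{k-1}$. Nice intervals and return maps: an open interval $J$ is nice if $f^n(\partial J)\cap J=\emptyset$ for all $n\ge 0$. For $J\subset[0,1]$ let $D(J)=\{x\in[0,1]: f^k(x)\in J \text{ for some } k\ge 1\}$; a component of $J\cap D(J)$ is called a return domain of $J$. The first entry map $R_J:D(J)\to J$ is $x\mapsto f^{k(x)}(x)$, where $k(x)$ is the minimal positive integer with $f^{k(x)}(x)\in J$. If $I^1$ is a nice interval containing $c$ and, for each $n\geq 2$, $I^n$ is the return domain of $I^{n-1}$ containing $c$, then the sequence $I^1\supset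 I^2\supset I^3\supset\cdots$ is called the principal nest starting from $I^1$. *)

theory Defs
  imports "HOL-Analysis.Analysis"
begin

text \<open>
  Only the restriction of \<open>f\<close> to \<open>{0..1}\<close> matters; its values elsewhere are arbitrary.
  The critical point is the turning point, no differentiability is involved.
\<close>
definition unimodal :: "(real \<Rightarrow> real) \<Rightarrow> real \<Rightarrow> bool" where
  "unimodal f c \<longleftrightarrow>
     continuous_on {0..1} f \<and> f ` {0..1} \<subseteq> {0..1} \<and> c \<in> {0<..<1} \<and>
     strict_mono_on {0..c} f \<and> strict_antimono_on {c..1} f \<and> f 0 = 0 \<and> f 1 = 0"

text \<open>
  \<open>hat x\<close> is the point symmetric to \<open>x\<close> with respect to \<open>c\<close>. For unimodal \<open>f\<close> the conditions
  determine \<open>hat\<close> uniquely on \<open>{0..1}\<close>. The case of the Euclidean reflection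
  \<open>hat x = 2 * c - x\<close> is included, see \<open>symmetric_about_reflection\<close>.
\<close>
definition symmetric_about :: "real \<Rightarrow> (real \<Rightarrow> real) \<Rightarrow> (real \<Rightarrow> real) \<Rightarrow> bool" where
  "symmetric_about c hat f \<longleftrightarrow>
     (\<forall>x\<in>{0..1}. hat x \<in> {0..1} \<and> f (hat x) = f x \<and> (x \<noteq> c \<longrightarrow> hat x \<noteq> x))"

lemma symmetric_about_reflection:
  assumes "\<And>x. x \<in> {0..1} \<Longrightarrow> 2 * c - x \<in> {0..1} \<and> f (2 * c - x) = f x"
  shows "symmetric_about c (\<lambda>x. 2 * c - x) f"
  using assms unfolding symmetric_about_def by auto

definition forward_orbit :: "(real \<Rightarrow> real) \<Rightarrow> real \<Rightarrow> real set" where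
  "forward_orbit f c = {(f ^^ k) c | k. True}"

fun S :: "nat \<Rightarrow> nat" where
  "S 0 = 1"
| "S (Suc 0) = 2"
| "S (Suc (Suc k)) = S (Suc k) + S k"

definition nearest_preimage :: "(real \<Rightarrow> real) \<Rightarrow> real \<Rightarrow> nat \<Rightarrow> real \<Rightarrow> bool" where
  "nearest_preimage f c k x \<longleftrightarrow>
     x \<in> {0..1} \<and> (f ^^ k) x = c \<and>
     (\<forall>y\<in>{0..1}. (f ^^ k) y = c \<longrightarrow> dist x c \<le> dist y c)"

text \<open>
  Here \<open>p k\<close> plays the role of \<open>c\<^sub>-\<^sub>k\<close>. The sequence \<open>T\<close> is described by a predicate because
  the set whose minimum is taken may be empty; being such a sequence includes the existence of all
  the minima. The open interval with endpoints \<open>a\<close>, \<open>b\<close> in either order is \<open>open_segment a b\<close>.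
\<close>
definition closest_times ::
    "(nat \<Rightarrow> real) \<Rightarrow> (real \<Rightarrow> real) \<Rightarrow> (nat \<Rightarrow> nat) \<Rightarrow> bool" where
  "closest_times p hat T \<longleftrightarrow>
     T 0 = 1 \<and>
     (\<forall>i. let A = {k. k \<ge> T i \<and> p k \<in> open_segment (p (T i)) (hat (p (T i)))}
          in T (Suc i) \<in> A \<and> (\<forall>k\<in>A. T (Suc i) \<le> k))"

definition fibonacci_map :: "(real \<Rightarrow> real) \<Rightarrow> real \<Rightarrow> (real \<Rightarrow> real) \<Rightarrow> bool" where
  "fibonacci_map f c hat \<longleftrightarrow>
     (\<exists>p T. (\<forall>k. nearest_preimage f c k (p k)) \<and> closest_times p hat T \<and> (\<forall>i. T i = S i))"

definition nice :: "(real \<Rightarrow> real) \<Rightarrow> real set \<Rightarrow> bool" where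
  "nice f J \<longleftrightarrow>
     open J \<and> is_interval J \<and> J \<noteq> {} \<and> J \<subseteq> {0..1} \<and> (\<forall>n. (f ^^ n) ` frontier J \<inter> J = {})"

definition D :: "(real \<Rightarrow> real) \<Rightarrow> real set \<Rightarrow> real set" where
  "D f J = {x \<in> {0..1}. \<exists>k\<ge>1. (f ^^ k) x \<in> J}"

definition entry_time :: "(real \<Rightarrow> real) \<Rightarrow> real set \<Rightarrow> real \<Rightarrow> nat" where
  "entry_time f J x = (LEAST k. k \<ge> 1 \<and> (f ^^ k) x \<in> J)"

definition first_entry :: "(real \<Rightarrow> real) \<Rightarrow> real set \<Rightarrow> real \<Rightarrow> real" where
  "first_entry f J x = (f ^^ entry_time f J x) x"

definition return_domains :: "(real \<Rightarrow> real) \<Rightarrow> real set \<Rightarrow> real set set" where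
  "return_domains f J = components (J \<inter> D f J)"

text \<open>The value is \<open>{}\<close>, which is not a return domain, if \<open>c\<close> does not return to \<open>J\<close>.\<close>
definition central_return_domain :: "(real \<Rightarrow> real) \<Rightarrow> real \<Rightarrow> real set \<Rightarrow> real set" where
  "central_return_domain f c J = connected_component_set (J \<inter> D f J) c"

lemma central_return_domain_iff:
  "C = central_return_domain f c J \<and> C \<noteq> {} \<longleftrightarrow> C \<in> return_domains f J \<and> c \<in> C"
proof
  assume C: "C = central_return_domain f c J \<and> C \<noteq> {}"
  then have "c \<in> J \<inter> D f J"
    using connected_component_eq_empty[of "J \<inter> D f J" c]
    unfolding central_return_domain_def by blast
  then show "C \<in> return_domains f J \<and> c \<in> C"
    using C connected_component_refl[of c "J \<inter> D f J"] componentsI[of c "J \<inter> D f J"]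
    unfolding central_return_domain_def return_domains_def by simp
next
  assume C: "C \<in> return_domains f J \<and> c \<in> C"
  then obtain x where "C = connected_component_set (J \<inter> D f J) x"
    unfolding return_domains_def components_def by blast
  then have "C = connected_component_set (J \<inter> D f J) c"
    using C connected_component_eq[of c "J \<inter> D f J" x] by simp
  then show "C = central_return_domain f c J \<and> C \<noteq> {}"
    using C unfolding central_return_domain_def by blast
qed

text \<open>The numbering starts at \<open>k = 1\<close>, where the value is \<open>J\<close>.\<close>
definition principal_nest :: "(real \<Rightarrow> real) \<Rightarrow> real \<Rightarrow> real set \<Rightarrow> nat \<Rightarrow> real set" where
  "principal_nest f c J k = (central_return_domain f c ^^ (k - 1)) J"

lemma starting_interval_nice:
  assumes u: "unimodal f c" and s: "symmetric_about c hat f"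
    and q: "q \<in> {c<..<1}" "f q = q"
  shows "nice f (open_segment (hat q) q)" "c \<in> open_segment (hat q) q"
proof -
  have c01: "0 < c" "c < 1" and anti: "strict_antimono_on {c..1} f"
    using u by (auto simp: unimodal_def)
  have h: "hat q \<in> {0..1}" "f (hat q) = q" "hat q \<noteq> q"
    using s q c01 unfolding symmetric_about_def by fastforce+
  have "hat q < c"
  proof (rule ccontr)
    assume "\<not> hat q < c"
    then consider "c \<le> hat q" "hat q < q" | "q < hat q" using h(3) by linarith
    then have "f (hat q) \<noteq> f q"
    proof cases
      case 1 then show ?thesis using monotone_onD[OF anti, of "hat q" q] q h by auto
    next
      case 2 then show ?thesis using monotone_onD[OF anti, of q "hat q"] q h by auto
    qed
    then show False using h q by simp
  qed
  then have seg: "open_segment (hat q) q = {hat q<..<q}" "hat q < q"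
    using q by (auto simp: open_segment_eq_real_ivl)
  have it: "(f ^^ n) q = q" for n by (induction n) (use q in auto)
  have it': "(f ^^ n) (hat q) \<in> {hat q, q}" for n
  proof (cases n)
    case (Suc m) then show ?thesis by (simp add: funpow_swap1 h it)
  qed simp
  show "c \<in> open_segment (hat q) q" using seg q \<open>hat q < c\<close> by auto
  have fr: "frontier {hat q<..<q} = {hat q, q}" using seg(2) by (auto simp: frontier_def)
  have "(f ^^ n) ` frontier {hat q<..<q} \<inter> {hat q<..<q} = {}" for n
    using it[of n] it'[of n] by (auto simp: fr)
  moreover have "{hat q<..<q} \<subseteq> {0..1}" using h q by auto
  moreover have "is_interval {hat q<..<q}" by (simp add: is_interval_oo)
  moreover have "{hat q<..<q} \<noteq> {}" using seg by simp
  ultimately show "nice f (open_segment (hat q) q)"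
    by (simp add: seg nice_def)
qed

end

theory Submission
  imports Defs
begin

text \<open>
  Intervals symmetric about \<open>c\<close> are superlevel sets \<open>L t = {x. f x > t}\<close>, so the map \<open>hat\<close> and the
  left-right bookkeeping disappear: \<open>L t\<close> is nice iff \<open>f\<^sup>i t \<le> t\<close> for all \<open>i\<close>, the nest is \<open>I\<^sup>k = L t\<^sub>k\<close>,
  and a \<open>k\<close>-th preimage of \<open>c\<close> is nearest to \<open>c\<close> iff its image under \<open>f\<close> is maximal.

  Let \<open>f\<close> be Fibonacci and let \<open>r\<^sub>k\<close> be the image under \<open>f\<close> of the nearest \<open>S\<^sub>k\<close>-th preimage. As \<open>L r\<^sub>k\<close>
  contains no \<open>j\<close>-th preimage with \<open>1 \<le> j < S\<^sub>k\<^sub>+\<^sub>1\<close>, the point \<open>f\<^bsup>S k\<^esup> c\<close> lies in \<open>L r\<^sub>k\<^sub>-\<^sub>2\<close> but not in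
  \<open>L r\<^sub>k\<^sub>-\<^sub>1\<close>, and inductively \<open>r\<^sub>k\<^sub>-\<^sub>1 < t\<^sub>k < r\<^sub>k\<close> with return time \<open>S\<^sub>k\<^sub>+\<^sub>1\<close> of \<open>c\<close> to \<open>I\<^sup>k\<close>. For
  \<open>S\<^sub>m \<le> i < S\<^sub>m\<^sub>+\<^sub>1\<close> and \<open>m \<ge> k + 2\<close> the points \<open>f\<^sup>i c\<close> and \<open>f\<^sup>j c\<close>, \<open>j = i - S\<^sub>m\<close>, both lie in
  \<open>f\<^sup>j I\<^sup>m\<^sup>-\<^sup>1\<close>, which is in one return domain of \<open>I\<^sup>k\<close> as soon as it meets \<open>I\<^sup>k\<close>; so all visits of the
  critical orbit to \<open>I\<^sup>k\<close> are in the return domains of \<open>c\<close> and of its first return.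

  Conversely, (2) and (3) put \<open>f\<^bsup>S (k+1)\<^esup> c\<close> into \<open>I\<^sup>k - I\<^sup>k\<^sup>+\<^sup>1\<close>. Hence the critical orbit is infinite and
  the return times are the prescribed ones. Then \<open>I\<^sup>k\<close> contains no \<open>j\<close>-th preimage of \<open>c\<close> with \<open>1 \<le> j < S\<^sub>k\<close>,
  but an \<open>S\<^sub>k\<close>-th one, since otherwise \<open>f\<^bsup>S k\<^esup>\<close> would be monotone on \<open>[t\<^sub>k, f c]\<close>, with values
  at most \<open>t\<^sub>k\<close> at the ends but a larger one at \<open>f (f\<^bsup>S (k+1)\<^esup> c)\<close>.
\<close>

section \<open>Fibonacci numbers\<close>

lemma S_pos: "1 \<le> S k"
  by (induction k rule: S.induct) auto

lemma S_less_Suc: "S k < S (Suc k)"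
  using S_pos by (induction k rule: S.induct) (auto simp: less_eq_Suc_le)

lemma strict_mono_S: "strict_mono S"
  using S_less_Suc by (simp add: strict_mono_Suc_iff)

lemma S_interval:
  assumes "S k \<le> i"
  obtains m where "k \<le> m" "S m \<le> i" "i < S (Suc m)"
proof -
  have "m \<le> S m" for m using strict_mono_imp_increasing[OF strict_mono_S] .
  then have "finite {m. S m \<le> i}"
    by (intro finite_subset[OF _ finite_atMost[of i]]) (auto intro: order_trans)
  moreover from this have "Max {m. S m \<le> i} \<in> {m. S m \<le> i}"
    using assms by (intro Max_in) auto
  ultimately show ?thesis
    using assms that[of "Max {m. S m \<le> i}"] Max_ge[of "{m. S m \<le> i}"]
    by (metis lessI linorder_not_le mem_Collect_eq)
qed

subsection \<open>Iterates of a unimodal map\<close>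

locale symmetric_unimodal =
  fixes f hat :: "real \<Rightarrow> real" and c q :: real
  assumes unimodal: "unimodal f c"
    and symmetric: "symmetric_about c hat f"
    and q: "q \<in> {c<..<1}"
    and fixed_q: "f q = q"
begin

lemma c_bounds: "0 < c" "c < 1" "c < q" "q < 1"
  using unimodal q by (auto simp: unimodal_def)

lemma c_in: "c \<in> {0..1}" and q_in: "q \<in> {0..1}"
  using c_bounds by auto

lemma cont_f: "continuous_on {0..1} f"
  using unimodal by (simp add: unimodal_def)

lemma f_in: "x \<in> {0..1} \<Longrightarrow> f x \<in> {0..1}"
  using unimodal unfolding unimodal_def by blast

lemma f_0: "f 0 = 0" and f_1: "f 1 = 0"
  using unimodal by (auto simp: unimodal_def)

lemma f_increasing: "0 \<le> x \<Longrightarrow> x < y \<Longrightarrow> y \<le> c \<Longrightarrow> f x < f y"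
  using unimodal monotone_onD[of "{0..c}" "(<)" "(<)" f x y] by (auto simp: unimodal_def)

lemma f_decreasing: "c \<le> x \<Longrightarrow> x < y \<Longrightarrow> y \<le> 1 \<Longrightarrow> f y < f x"
  using unimodal monotone_onD[of "{c..1}" "(<)" "(>)" f x y] by (auto simp: unimodal_def)

lemma f_less_max: "x \<in> {0..1} \<Longrightarrow> x \<noteq> c \<Longrightarrow> f x < f c"
  using f_increasing[of x c] f_decreasing[of c x] by force

lemma f_le_max: "x \<in> {0..1} \<Longrightarrow> f x \<le> f c"
  using f_less_max[of x] by fastforce

lemma f_eq_max_iff: "x \<in> {0..1} \<Longrightarrow> f x = f c \<longleftrightarrow> x = c"
  using f_less_max[of x] by fastforce

lemma f_eq_opposite:
  assumes "x \<in> {0..1}" "y \<in> {0..1}" "f x = f y" "x < y"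
  shows "x < c \<and> c < y"
  using assms f_increasing[of x y] f_decreasing[of x y] by fastforce

lemma q_less_max: "q < f c"
  using f_less_max[OF q_in] fixed_q c_bounds by simp

lemma max_in: "f c \<in> {0..1}"
  using f_in[OF c_in] .

lemma f_attains:
  assumes "0 \<le> v" "v \<le> f c"
  shows "\<exists>x\<in>{0..1}. f x = v"
proof -
  have "continuous_on {0..c} f"
    using c_bounds by (intro continuous_on_subset[OF cont_f]) auto
  then obtain x where "0 \<le> x" "x \<le> c" "f x = v"
    using IVT'[of f 0 v c] assms f_0 c_bounds by auto
  then show ?thesis using c_bounds by auto
qed

lemma iter_in: "x \<in> {0..1} \<Longrightarrow> (f ^^ n) x \<in> {0..1}"
  by (induction n) (use f_in in auto)

lemma cont_iter: "continuous_on {0..1} (f ^^ n)"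
proof (induction n)
  case (Suc n)
  have "continuous_on ((f ^^ n) ` {0..1}) f"
    using iter_in by (intro continuous_on_subset[OF cont_f]) auto
  then show ?case using continuous_on_compose[OF Suc] by (simp add: comp_def)
qed auto

lemma iter_add: "(f ^^ m) ((f ^^ n) x) = (f ^^ (m + n)) x"
  by (simp add: funpow_add)

lemma iter_Suc: "(f ^^ n) (f x) = (f ^^ Suc n) x"
  by (simp add: funpow_swap1)

lemma iter_ivt:
  assumes "x \<in> A" "y \<in> A" "A \<subseteq> {0..1}" "connected A" "(f ^^ n) x \<le> v" "v \<le> (f ^^ n) y"
  shows "\<exists>w\<in>A. (f ^^ n) w = v"
proof -
  have "connected ((f ^^ n) ` A)"
    using assms by (intro connected_continuous_image continuous_on_subset[OF cont_iter])
  then have "v \<in> (f ^^ n) ` A"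
    using assms connectedD_interval[of "(f ^^ n) ` A" "(f ^^ n) x" "(f ^^ n) y" v] by blast
  then show ?thesis by blast
qed

lemma iter_ivt_interval:
  assumes "0 \<le> a" "a \<le> b" "b \<le> 1"
    and "(f ^^ n) a \<le> v \<and> v \<le> (f ^^ n) b \<or> (f ^^ n) b \<le> v \<and> v \<le> (f ^^ n) a"
  obtains w where "a \<le> w" "w \<le> b" "(f ^^ n) w = v"
proof -
  have "a \<in> {a..b}" "b \<in> {a..b}" "{a..b} \<subseteq> {0..1}" "connected {a..b}"
    using assms by auto
  then obtain w where "w \<in> {a..b}" "(f ^^ n) w = v"
    using iter_ivt[of a "{a..b}" b n v] iter_ivt[of b "{a..b}" a n v] assms(4) by blast
  then show ?thesis using that[of w] by simp
qed

text \<open>By induction: if \<open>f ^^ Suc m\<close> identifies two points that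
  \<open>f ^^ m\<close> separates, their images under \<open>f ^^ m\<close> lie on opposite sides of
  \<open>c\<close>, so \<open>f ^^ m\<close> takes the value \<open>c\<close> strictly between the
  points.\<close>

lemma iter_inj:
  assumes "0 \<le> a" "b \<le> 1" "\<And>v j. a < v \<Longrightarrow> v < b \<Longrightarrow> j < m \<Longrightarrow> (f ^^ j) v \<noteq> c"
  shows "inj_on (f ^^ m) {a..b}"
  using assms(3)
proof (induction m)
  case (Suc m)
  have distinct: "(f ^^ Suc m) x \<noteq> (f ^^ Suc m) y" if xy: "a \<le> x" "x < y" "y \<le> b" for x y
  proof
    assume eq: "(f ^^ Suc m) x = (f ^^ Suc m) y"
    have ne: "(f ^^ m) x \<noteq> (f ^^ m) y"
      using inj_onD[OF Suc.IH, of x y] Suc.prems that by force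
    have "(f ^^ m) x \<in> {0..1}" "(f ^^ m) y \<in> {0..1}"
      using assms that by (auto intro!: iter_in simp del: atLeastAtMost_iff) auto
    then have side: "(f ^^ m) x < c \<and> c < (f ^^ m) y \<or> (f ^^ m) y < c \<and> c < (f ^^ m) x"
      using f_eq_opposite[of "(f ^^ m) x" "(f ^^ m) y"] f_eq_opposite[of "(f ^^ m) y" "(f ^^ m) x"] eq ne
      by fastforce
    obtain w where w: "x \<le> w" "w \<le> y" "(f ^^ m) w = c"
      by (rule iter_ivt_interval[of x y m c]) (use side xy assms(1,2) in auto)
    then have "x < w" "w < y" using side by (auto simp: less_le)
    then show False using Suc.prems[of w m] that w by simp
  qed
  show ?case
  proof (rule inj_onI)
    fix x y assume "x \<in> {a..b}" "y \<in> {a..b}" "(f ^^ Suc m) x = (f ^^ Suc m) y"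
    then show "x = y" using distinct[of x y] distinct[of y x] by (cases x y rule: linorder_cases) auto
  qed
qed simp

lemma iter_mono:
  assumes "0 \<le> a" "b \<le> 1" "a < x" "x < b" "inj_on (f ^^ m) {a..b}"
  shows "(f ^^ m) a < (f ^^ m) x \<and> (f ^^ m) x < (f ^^ m) b \<or>
         (f ^^ m) b < (f ^^ m) x \<and> (f ^^ m) x < (f ^^ m) a"
  using assms by (intro continuous_inj_imp_mono continuous_on_subset[OF cont_iter]) auto

section \<open>Superlevel sets and nice levels\<close>

definition superlevel :: "real \<Rightarrow> real set" where
  "superlevel t = {x \<in> {0..1}. t < f x}"

text \<open>Both endpoints of \<open>superlevel t\<close> have image \<open>t\<close>, so their
  \<open>n\<close>-th iterates avoid \<open>superlevel t\<close> exactly when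
  \<open>(f ^^ n) t \<le> t\<close>.\<close>

definition nice_level :: "real \<Rightarrow> bool" where
  "nice_level t \<longleftrightarrow> 0 \<le> t \<and> t < f c \<and> (\<forall>i. (f ^^ i) t \<le> t)"

lemma superlevel_antimono: "s \<le> t \<Longrightarrow> superlevel t \<subseteq> superlevel s"
  by (auto simp: superlevel_def)

lemma iter_in_superlevel:
  "x \<in> {0..1} \<Longrightarrow> (f ^^ k) x \<in> superlevel t \<longleftrightarrow> t < (f ^^ Suc k) x"
  using iter_in[of x k] by (simp add: superlevel_def)

lemma superlevel_eq:
  assumes "0 \<le> t" "t < f c"
  obtains a b where "0 \<le> a" "a < c" "c < b" "b \<le> 1" "f a = t" "f b = t" "superlevel t = {a<..<b}"
proof -
  have "continuous_on {0..c} f" "continuous_on {c..1} f"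
    using c_bounds by (auto intro!: continuous_on_subset[OF cont_f])
  then obtain a b where a: "0 \<le> a" "a \<le> c" "f a = t" and b: "c \<le> b" "b \<le> 1" "f b = t"
    using IVT'[of f 0 t c] IVT2'[of f 1 t c] assms f_0 f_1 c_bounds by auto
  then have ne: "a \<noteq> c" "b \<noteq> c" using assms by auto
  have "t < f x \<longleftrightarrow> a < x \<and> x < b" if "x \<in> {0..1}" for x
  proof (cases "x \<le> c")
    case True
    then show ?thesis
      using f_increasing[of a x] f_increasing[of x a] a b ne that by (cases a x rule: linorder_cases) auto
  next
    case False
    then show ?thesis
      using f_decreasing[of b x] f_decreasing[of x b] a b ne that by (cases b x rule: linorder_cases) auto
  qed
  then have "superlevel t = {a<..<b}"
    using a b by (auto simp: superlevel_def)
  then show ?thesis using a b ne by (intro that[of a b]) auto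
qed

lemma connected_superlevel: "0 \<le> t \<Longrightarrow> t < f c \<Longrightarrow> connected (superlevel t)"
  by (erule (1) superlevel_eq) (simp add: is_interval_connected is_interval_oo)

lemma Inf_image_superlevel:
  assumes "0 \<le> t" "t < f c"
  shows "Inf (f ` superlevel t) = t"
proof -
  have "{t<..f c} \<subseteq> f ` superlevel t"
  proof
    fix v assume "v \<in> {t<..f c}"
    then show "v \<in> f ` superlevel t"
      using assms f_attains[of v] by (force simp: superlevel_def)
  qed
  then have "f ` superlevel t = {t<..f c}"
    using f_le_max by (auto simp: superlevel_def)
  then show ?thesis using assms by (simp add: cInf_greaterThanAtMost)
qed

section \<open>The involution \<open>hat\<close> and nearest preimages\<close>

lemma hat_in: "x \<in> {0..1} \<Longrightarrow> hat x \<in> {0..1}"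
  and f_hat: "x \<in> {0..1} \<Longrightarrow> f (hat x) = f x"
  and hat_neq: "x \<in> {0..1} \<Longrightarrow> x \<noteq> c \<Longrightarrow> hat x \<noteq> x"
  using symmetric by (auto simp: symmetric_about_def)

lemma hat_opposite:
  assumes "x \<in> {0..1}"
  shows "x < c \<Longrightarrow> c < hat x" "c < x \<Longrightarrow> hat x < c" "x = c \<Longrightarrow> hat x = c"
  using f_eq_opposite[of x "hat x"] f_eq_opposite[of "hat x" x] assms hat_in[OF assms]
    f_hat[OF assms] hat_neq[OF assms] f_eq_max_iff[of "hat x"] by fastforce+

text \<open>For \<open>x \<noteq> c\<close> the points \<open>x\<close> and \<open>hat x\<close> are
  the two solutions of \<open>f y = f x\<close>, one on each side of \<open>c\<close>, hence the
  endpoints of the superlevel set. For \<open>x = c\<close> both sets are empty.\<close>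

lemma open_segment_hat:
  assumes x: "x \<in> {0..1}"
  shows "open_segment x (hat x) = superlevel (f x)"
proof (cases "x = c")
  case True
  then show ?thesis using hat_opposite(3)[OF x] f_le_max by (force simp: superlevel_def)
next
  case False
  then have "0 \<le> f x" "f x < f c" using f_in[OF x] f_less_max[OF x] by auto
  then obtain a b where ab: "0 \<le> a" "a < c" "c < b" "b \<le> 1" "f a = f x" "f b = f x"
      "superlevel (f x) = {a<..<b}" by (rule superlevel_eq)
  have in01: "a \<in> {0..1}" "b \<in> {0..1}" using ab by auto
  show ?thesis
  proof (cases "x < c")
    case True
    have "x = a" "hat x = b"
      using f_eq_opposite[of x a] f_eq_opposite[of a x] f_eq_opposite[of "hat x" b]
        f_eq_opposite[of b "hat x"] True x hat_in[OF x] f_hat[OF x] hat_opposite(1)[OF x] ab in01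
      by (metis linorder_neqE order_less_asym)+
    then show ?thesis using ab by (simp add: open_segment_eq_real_ivl)
  next
    case 2: False
    then have eq: "x = b" "hat x = a"
      using f_eq_opposite[of x b] f_eq_opposite[of b x] f_eq_opposite[of "hat x" a]
        f_eq_opposite[of a "hat x"] False x hat_in[OF x] f_hat[OF x] hat_opposite(2)[OF x] ab in01
      by (metis linorder_neqE order_less_asym)+
    have "open_segment b a = {a<..<b}" using ab(2,3) by (simp add: open_segment_eq_real_ivl)
    then show ?thesis using ab(7) unfolding eq(2) unfolding eq(1) by simp
  qed
qed

text \<open>As \<open>k \<ge> 1\<close>, both \<open>y\<close> and \<open>hat y\<close> are
  \<open>k\<close>-th preimages, and one of them lies on the same side of \<open>c\<close> as
  \<open>p\<close>. On that side \<open>f\<close> is strictly monotone, so a point nearer to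
  \<open>c\<close> has a larger image.\<close>

lemma nearest_preimage_maximal:
  assumes p: "nearest_preimage f c k p" and k: "1 \<le> k"
    and y: "y \<in> {0..1}" "(f ^^ k) y = c"
  shows "f y \<le> f p"
proof (rule ccontr)
  assume less: "\<not> f y \<le> f p"
  have p_in: "p \<in> {0..1}" and near: "\<And>z. z \<in> {0..1} \<Longrightarrow> (f ^^ k) z = c \<Longrightarrow> dist p c \<le> dist z c"
    using p by (auto simp: nearest_preimage_def)
  obtain m where "k = Suc m" using k by (cases k) auto
  then have "(f ^^ k) (hat y) = c"
    using y f_hat[OF y(1)] iter_Suc[of m y] iter_Suc[of m "hat y"] by simp
  then have *: "dist p c \<le> dist y c" "dist p c \<le> dist (hat y) c"
    using near y hat_in by auto
  obtain z where z: "z \<in> {y, hat y}" "z \<le> c \<and> p \<le> c \<or> c \<le> z \<and> c \<le> p"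
    using hat_opposite[OF y(1)] by (metis insertCI linorder_le_cases linorder_neqE order_le_less)
  have zz: "z \<in> {0..1}" "f z = f y" "dist p c \<le> dist z c" using z y hat_in f_hat * by auto
  show False
    using f_increasing[of z p] f_decreasing[of p z] zz z(2) p_in less
    by (cases "z = p") (auto simp: dist_real_def)
qed

lemma nearest_preimage_exists: "\<exists>p. nearest_preimage f c k p"
proof -
  let ?P = "{x \<in> {0..1}. (f ^^ k) x = c}"
  have "\<exists>x\<in>{0..1}. (f ^^ k) x = c"
  proof (induction k)
    case 0
    then show ?case using c_in by auto
  next
    case (Suc k)
    obtain x where x: "x \<in> {0..1}" "(f ^^ k) x = c" using Suc by blast
    \<comment> \<open>The value is \<open>f c\<close>, which exceeds \<open>q\<close> and hence
      \<open>c\<close>; since \<open>0\<close> is fixed, the value \<open>c\<close> is taken in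
      between.\<close>
    then have "c \<le> (f ^^ Suc k) x" using q_less_max c_bounds by simp
    moreover have "(f ^^ Suc k) 0 = 0" by (induction k) (auto simp: f_0)
    ultimately show ?case
      using iter_ivt[of 0 "{0..1}" x "Suc k" c] x c_bounds by auto
  qed
  then have ne: "?P \<noteq> {}" by blast
  have "closed ?P"
    using continuous_closed_preimage[OF cont_iter, of "{c}" k]
    by (simp add: vimage_def Int_def) 
  then have "compact ({0..1} \<inter> ?P)"
    by (intro compact_Int_closed) auto
  moreover have "{0..1} \<inter> ?P = ?P" by blast
  ultimately have "compact ?P" by argo
  moreover have "continuous_on ?P (\<lambda>x. dist x c)" by (intro continuous_intros)
  ultimately obtain p where "p \<in> ?P" "\<forall>y\<in>?P. dist p c \<le> dist y c"
    using continuous_attains_inf[of ?P "\<lambda>x. dist x c"] ne by blast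
  then show ?thesis by (auto simp: nearest_preimage_def)
qed

subsection \<open>Central return domains\<close>

text \<open>Phrased for values \<open>v = f x\<close>: the \<open>i\<close>-th iterate of
  \<open>x\<close> is in \<open>superlevel t\<close> iff \<open>t < (f ^^ i) v\<close>. Thus all
  points of \<open>superlevel s\<close> first return to \<open>superlevel t\<close> at time
  \<open>n\<close>, while points of value \<open>s\<close> never do.\<close>

definition return_level :: "real \<Rightarrow> nat \<Rightarrow> real \<Rightarrow> bool" where
  "return_level t n s \<longleftrightarrow> t \<le> s \<and> s < f c \<and> (f ^^ n) s = t \<and> (\<forall>i\<ge>1. (f ^^ i) s \<le> t) \<and>
     (\<forall>v. s < v \<longrightarrow> v \<le> f c \<longrightarrow> t < (f ^^ n) v \<and> (\<forall>i. 1 \<le> i \<longrightarrow> i < n \<longrightarrow> (f ^^ i) v \<le> t))"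

lemma nice_level_return: "nice_level t \<Longrightarrow> return_level t n s \<Longrightarrow> nice_level s"
  unfolding nice_level_def return_level_def
  by (metis One_nat_def Suc_leI funpow_0 neq0_conv order_refl order_trans)

lemma D_superlevel: "D f (superlevel t) = {x \<in> {0..1}. \<exists>k\<ge>1. t < (f ^^ k) (f x)}"
  unfolding D_def using iter_in_superlevel iter_Suc by auto

lemma entry_time_eq:
  assumes "x \<in> {0..1}" "1 \<le> n" "t < (f ^^ n) (f x)"
    and "\<And>i. 1 \<le> i \<Longrightarrow> i < n \<Longrightarrow> (f ^^ i) (f x) \<le> t"
  shows "entry_time f (superlevel t) x = n"
  unfolding entry_time_def
  using assms iter_in_superlevel[OF assms(1)] iter_Suc
  by (intro Least_equality) (auto simp: not_le[symmetric])

text \<open>The level \<open>s\<close> is the left end of the largest interval in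
  \<open>{t..f c}\<close> ending at \<open>f c\<close> on which \<open>f ^^ n\<close> exceeds
  \<open>t\<close>. An earlier iterate exceeding \<open>t\<close> would have to cross
  \<open>t\<close>, and niceness would then keep the later ones at most \<open>t\<close>.\<close>

lemma return_level_exists:
  assumes nice: "nice_level t" and n: "1 \<le> n" "t < (f ^^ n) (f c)"
    and first: "\<And>i. 1 \<le> i \<Longrightarrow> i < n \<Longrightarrow> (f ^^ i) (f c) \<le> t"
  shows "\<exists>s. return_level t n s"
proof -
  define A where "A = {s \<in> {t..f c}. \<forall>v\<in>{s..f c}. t < (f ^^ n) v}"
  define s where "s = Inf A"
  have t: "0 \<le> t" "t < f c" "\<And>i. (f ^^ i) t \<le> t" using nice by (auto simp: nice_level_def)
  have top: "f c \<le> 1" using max_in by simp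
  have fc: "f c \<in> A" using n t by (auto simp: A_def)
  have bdd: "bdd_below A" by (auto simp: A_def intro: bdd_belowI[of _ t])
  have "t \<le> s"
    unfolding s_def using fc by (intro cInf_greatest) (auto simp: A_def)
  moreover have "s \<le> f c"
    unfolding s_def using fc bdd by (intro cInf_lower)
  ultimately have s: "t \<le> s" "s \<le> f c" .
  have above: "t < (f ^^ n) v" if v: "s < v" "v \<le> f c" for v
  proof -
    obtain a where "a \<in> A" "a < v"
      using cInf_lessD[of A v] fc v unfolding s_def by blast
    then show ?thesis using v by (auto simp: A_def)
  qed
  have le: "(f ^^ n) s \<le> t"
  proof (rule ccontr)
    assume gt: "\<not> (f ^^ n) s \<le> t"
    \<comment> \<open>Niceness excludes \<open>s = t\<close>. This leaves room to extend the
      interval to the left by continuity, against the choice of \<open>s\<close> as infimum.\<close>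
    then have "t < s" using t(3)[of n] s by (metis order_le_less)
    have "s \<in> {0..1}" using s t top by auto
    then obtain d where d: "d > 0"
      "\<And>v. v \<in> {0..1} \<Longrightarrow> dist v s < d \<Longrightarrow> dist ((f ^^ n) v) ((f ^^ n) s) < (f ^^ n) s - t"
      using cont_iter[of n] gt unfolding continuous_on_iff by (meson diff_gt_0_iff_gt not_le)
    define a where "a = max t (s - d / 2)"
    have "t < (f ^^ n) v" if "v \<in> {a..f c}" for v
    proof (cases "s < v")
      case True
      then show ?thesis using above that by simp
    next
      case False
      then have "v \<in> {0..1}" "dist v s < d"
        using that s t top d(1) by (auto simp: a_def dist_real_def)
      from d(2)[OF this] show ?thesis by (auto simp: dist_real_def abs_if split: if_splits)
    qed
    then have "a \<in> A" using s t \<open>t < s\<close> d(1) by (auto simp: A_def a_def)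
    then have "s \<le> a" unfolding s_def using bdd by (rule cInf_lower)
    then show False using \<open>t < s\<close> d(1) by (auto simp: a_def max_def split: if_splits)
  qed
  have less: "s < f c" using le n s by (metis not_le order_le_less)
  have eq: "(f ^^ n) s = t"
  proof -
    obtain w where w: "s \<le> w" "w \<le> f c" "(f ^^ n) w = t"
      using iter_ivt_interval[of s "f c" n t] le n less s t top by auto
    then show ?thesis using above[of w] by (cases "s < w") auto
  qed
  have before: "(f ^^ i) v \<le> t" if v: "s \<le> v" "v \<le> f c" and i: "1 \<le> i" "i < n" for v i
  proof (rule ccontr)
    assume gt: "\<not> (f ^^ i) v \<le> t"
    then obtain w where w: "v \<le> w" "w \<le> f c" "(f ^^ i) w = t"
      using iter_ivt_interval[of v "f c" i t] first[OF i] v s t top by auto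
    then have "w \<noteq> v" using gt by auto
    then have "s < w" using w v by simp
    then have "t < (f ^^ n) w" using above w by simp
    also have "(f ^^ n) w = (f ^^ (n - i)) t"
      using w i iter_add[of "n - i" i w] by simp
    finally show False using t(3)[of "n - i"] by simp
  qed
  have "(f ^^ i) s \<le> t" if "1 \<le> i" for i
  proof (cases "i < n")
    case True
    then show ?thesis using before[of s i] that s by simp
  next
    case False
    then show ?thesis using iter_add[of "i - n" n s] eq t(3)[of "i - n"] by simp
  qed
  then show ?thesis
    using s less eq above before unfolding return_level_def by (intro exI[of _ s]) auto
qed

lemma superlevel_subset_D:
  assumes "return_level t n s" "1 \<le> n"
  shows "superlevel s \<subseteq> superlevel t \<inter> D f (superlevel t)"
  using assms f_le_max unfolding return_level_def D_superlevel by (fastforce simp: superlevel_def)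

text \<open>A connected set containing \<open>c\<close> and reaching outside
  \<open>superlevel s\<close> has a point of value \<open>s\<close>; all later values of that point
  are at most \<open>t\<close>, so it does not return.\<close>

lemma central_return_domain_superlevel:
  assumes nice: "nice_level t" and ret: "return_level t n s" and n: "1 \<le> n"
  shows "central_return_domain f c (superlevel t) = superlevel s"
proof
  have s: "t \<le> s" "s < f c" "0 \<le> s" and below: "\<And>i. 1 \<le> i \<Longrightarrow> (f ^^ i) s \<le> t"
    using nice ret by (auto simp: return_level_def nice_level_def)
  have c_s: "c \<in> superlevel s" using c_in s by (simp add: superlevel_def)
  let ?C = "connected_component_set (superlevel t \<inter> D f (superlevel t)) c"
  show "superlevel s \<subseteq> central_return_domain f c (superlevel t)"
    unfolding central_return_domain_def
    by (intro connected_component_maximal c_s connected_superlevel superlevel_subset_D[OF ret n] s)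
  show "central_return_domain f c (superlevel t) \<subseteq> superlevel s"
  proof (rule ccontr)
    assume "\<not> central_return_domain f c (superlevel t) \<subseteq> superlevel s"
    then obtain x where x: "x \<in> ?C" "x \<notin> superlevel s"
      unfolding central_return_domain_def by blast
    have sub: "?C \<subseteq> superlevel t \<inter> D f (superlevel t)"
      by (rule connected_component_subset)
    then have C01: "?C \<subseteq> {0..1}" by (auto simp: superlevel_def)
    then have "f x \<le> s" using x unfolding superlevel_def by force
    moreover have "c \<in> ?C"
      using c_s superlevel_subset_D[OF ret n] by (auto intro: connected_component_refl)
    ultimately obtain y where y: "y \<in> ?C" "f y = s"
      using iter_ivt[OF x(1) _ C01, of c 1 s] s by auto
    then obtain k where "1 \<le> k" "t < (f ^^ k) s"
      using sub unfolding D_superlevel by auto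
    then show False using below[of k] by simp
  qed
qed

section \<open>The principal nest as a sequence of levels\<close>

definition nest :: "nat \<Rightarrow> real set" where
  "nest = principal_nest f c (open_segment (hat q) q)"

text \<open>Recovers \<open>t\<close> from \<open>nest k = superlevel t\<close>; it is meaningful
  once \<open>superlevel_nest k\<close> is known.\<close>

definition level :: "nat \<Rightarrow> real" where
  "level k = Inf (f ` nest k)"

lemma nice_level_q: "nice_level q"
proof -
  have "(f ^^ i) q = q" for i by (induction i) (auto simp: fixed_q)
  then show ?thesis using c_bounds q_less_max by (simp add: nice_level_def)
qed

lemma nest_1: "nest 1 = superlevel q"
  using open_segment_hat[OF q_in] fixed_q
  by (simp add: nest_def principal_nest_def open_segment_commute)

lemma nest_Suc: "1 \<le> k \<Longrightarrow> nest (Suc k) = central_return_domain f c (nest k)"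
  by (cases k) (simp_all add: nest_def principal_nest_def)

lemma level_eq: "nest k = superlevel t \<Longrightarrow> nice_level t \<Longrightarrow> level k = t"
  by (simp add: level_def nice_level_def Inf_image_superlevel)

definition superlevel_nest :: "nat \<Rightarrow> bool" where
  "superlevel_nest k \<longleftrightarrow> nest k = superlevel (level k) \<and> nice_level (level k)"

lemma level_1: "level 1 = q"
  using level_eq[OF nest_1 nice_level_q] .

lemma superlevel_nest_1: "superlevel_nest 1"
  using level_1 nest_1 nice_level_q by (simp add: superlevel_nest_def)

lemma superlevel_nest_Suc:
  assumes k: "1 \<le> k" and nest: "superlevel_nest k" and n: "1 \<le> n" "level k < (f ^^ n) (f c)"
    and first: "\<And>i. 1 \<le> i \<Longrightarrow> i < n \<Longrightarrow> (f ^^ i) (f c) \<le> level k"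
  shows "superlevel_nest (Suc k) \<and> return_level (level k) n (level (Suc k))"
proof -
  have nice: "nice_level (level k)" and eq: "nest k = superlevel (level k)"
    using nest by (auto simp: superlevel_nest_def)
  obtain s where s: "return_level (level k) n s"
    using return_level_exists[OF nice n first] by blast
  have "nest (Suc k) = superlevel s"
    using central_return_domain_superlevel[OF nice s n(1)] nest_Suc[OF k] eq by simp
  then show ?thesis
    using s level_eq nice_level_return[OF nice s] by (simp add: superlevel_nest_def)
qed

text \<open>The common ground of both directions: \<open>fib_nest\<close> at all indices from 1 on,
  together with (3), follows from either side and yields the other. The return clause looks back
  from \<open>k\<close> to \<open>k - 1\<close>, so \<open>k = 1\<close> has none.\<close>

definition fib_nest :: "nat \<Rightarrow> bool" where
  "fib_nest k \<longleftrightarrow>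
     superlevel_nest k \<and> (2 \<le> k \<longrightarrow> return_level (level (k - 1)) (S k) (level k))"

lemma fib_nest_1: "fib_nest 1"
  using superlevel_nest_1 by (simp add: fib_nest_def)

lemma fib_nest_Suc:
  assumes "1 \<le> k" "fib_nest k" "level k < (f ^^ S (Suc k)) (f c)"
    and "\<And>i. 1 \<le> i \<Longrightarrow> i < S (Suc k) \<Longrightarrow> (f ^^ i) (f c) \<le> level k"
  shows "fib_nest (Suc k)"
  using superlevel_nest_Suc[of k "S (Suc k)"] S_pos assms by (simp add: fib_nest_def)

lemma fib_nest_return:
  "1 \<le> k \<Longrightarrow> fib_nest (Suc k) \<Longrightarrow> return_level (level k) (S (Suc k)) (level (Suc k))"
  by (simp add: fib_nest_def)

lemma fib_nest_bounds: "fib_nest k \<Longrightarrow> 0 \<le> level k \<and> level k < f c"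
  by (simp add: fib_nest_def superlevel_nest_def nice_level_def)

lemma fib_nest_nice: "fib_nest k \<Longrightarrow> (f ^^ i) (level k) \<le> level k"
  by (simp add: fib_nest_def superlevel_nest_def nice_level_def)

lemma fib_nest_superlevel: "fib_nest k \<Longrightarrow> nest k = superlevel (level k)"
  by (simp add: fib_nest_def superlevel_nest_def)

lemma iter_mem_nest:
  assumes "fib_nest k" "x \<in> {0..1}"
  shows "(f ^^ i) x \<in> nest k \<longleftrightarrow> level k < (f ^^ i) (f x)"
  using iter_in_superlevel[OF assms(2)] fib_nest_superlevel[OF assms(1)] iter_Suc[of i x] by simp

text \<open>For \<open>k \<ge> 2\<close> a point of \<open>nest k\<close> does not even return to
  the larger \<open>nest (k - 1)\<close> before time \<open>S k\<close>. For \<open>k = 1\<close>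
  only \<open>i = 1\<close> occurs, and \<open>f\<close> is decreasing beyond its fixed point
  \<open>q\<close>.\<close>

lemma fib_nest_between:
  assumes k: "1 \<le> k" "fib_nest k" and v: "level k < v" "v \<le> f c" and i: "1 \<le> i" "i < S k"
  shows "(f ^^ i) v \<le> level k"
proof (cases "k = 1")
  case True
  then have "i = 1" using i by simp
  moreover have "f v \<le> f q"
    using f_decreasing[of q v] v True level_1 c_bounds max_in by simp
  ultimately show ?thesis using True level_1 fixed_q by simp
next
  case False
  then have "return_level (level (k - 1)) (S k) (level k)" using k by (simp add: fib_nest_def)
  then show ?thesis using v i unfolding return_level_def by (meson order_trans)
qed

subsection \<open>Return domains meeting the critical orbit\<close>

lemma level_mono:
  assumes "\<And>k. 1 \<le> k \<Longrightarrow> fib_nest k" "1 \<le> i" "i \<le> j"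
  shows "level i \<le> level j"
  using assms(3)
proof (induction j rule: dec_induct)
  case (step j)
  then have "return_level (level j) (S (Suc j)) (level (Suc j))"
    using assms by (intro fib_nest_return) auto
  then show ?case using step.IH by (simp add: return_level_def)
qed simp

lemma fib_nest_critical:
  assumes fib: "\<And>k. 1 \<le> k \<Longrightarrow> fib_nest k" and k: "1 \<le> k"
  shows "level k < (f ^^ S (Suc k)) (f c)"
  using fib_nest_return[OF k fib] fib_nest_bounds[OF fib, of "Suc k"] by (simp add: return_level_def)

text \<open>At time \<open>S (Suc m)\<close> all of \<open>nest (Suc m)\<close> is in
  \<open>nest m\<close>, hence in \<open>nest k\<close>. If its \<open>j\<close>-th image met
  \<open>nest k\<close> without being contained in it, some point would hit the boundary of
  \<open>nest k\<close>, and by niceness it could not be in \<open>nest k\<close> later.\<close>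

lemma iterated_nest_in_domain:
  assumes fib: "\<And>k. 1 \<le> k \<Longrightarrow> fib_nest k" and k: "1 \<le> k" "k \<le> m" and j: "j < S (Suc m)"
    and meet: "x \<in> nest (Suc m)" "(f ^^ j) x \<in> nest k"
  shows "(f ^^ j) ` nest (Suc m) \<subseteq> nest k \<inter> D f (nest k)"
proof -
  have ret: "return_level (level m) (S (Suc m)) (level (Suc m))"
    using fib k by (intro fib_nest_return) auto
  have mono: "level k \<le> level m" using level_mono[OF fib] k by simp
  have nest_m: "nest (Suc m) = superlevel (level (Suc m))" and nest_k: "nest k = superlevel (level k)"
    using fib_nest_superlevel fib k by simp_all
  have sub: "nest (Suc m) \<subseteq> {0..1}" by (auto simp: nest_m superlevel_def)
  have conn: "connected (nest (Suc m))"
    unfolding nest_m using fib_nest_bounds[OF fib, of "Suc m"] by (intro connected_superlevel) auto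
  have iter: "(f ^^ i) y \<in> nest k \<longleftrightarrow> level k < (f ^^ Suc i) y" if "y \<in> nest (Suc m)" for y i
    using iter_mem_nest[OF fib[OF k(1)], of y i] iter_Suc[of i y] that sub by auto
  have ret_y: "level k < (f ^^ Suc (S (Suc m))) y" if y: "y \<in> nest (Suc m)" for y
  proof -
    have "level (Suc m) < f y" "f y \<le> f c"
      using y f_le_max by (auto simp: nest_m superlevel_def)
    then show ?thesis
      using ret mono iter_Suc[of "S (Suc m)" y] unfolding return_level_def by fastforce
  qed
  have "(f ^^ j) y \<in> nest k \<inter> D f (nest k)" if y: "y \<in> nest (Suc m)" for y
  proof
    show "(f ^^ j) y \<in> nest k"
    proof (rule ccontr)
      assume "(f ^^ j) y \<notin> nest k"
      then obtain w where w: "w \<in> nest (Suc m)" "(f ^^ Suc j) w = level k"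
        using iter_ivt[OF y meet(1) sub conn, of "Suc j" "level k"] iter[OF y] iter[OF meet(1)] meet(2)
        by fastforce
      have "(f ^^ Suc (S (Suc m))) w = (f ^^ (S (Suc m) - j)) ((f ^^ Suc j) w)"
        using iter_add[of "S (Suc m) - j" "Suc j" w] j by simp
      then show False
        using ret_y[OF w(1)] w(2) fib_nest_nice[OF fib[OF k(1)], of "S (Suc m) - j"] by simp
    qed
    have "(f ^^ (S (Suc m) - j)) ((f ^^ j) y) \<in> nest k"
      using iter[OF y, of "S (Suc m)"] ret_y[OF y] iter_add[of "S (Suc m) - j" j y] j by simp
    then show "(f ^^ j) y \<in> D f (nest k)"
      unfolding D_def using iter_in[of y j] y sub j by (auto intro!: exI[of _ "S (Suc m) - j"])
  qed
  then show ?thesis by blast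
qed

text \<open>The return takes \<open>S k\<close> further steps: it leads to time
  \<open>S (Suc (Suc k))\<close>, when \<open>c\<close> is in \<open>nest (Suc k)\<close>.\<close>

lemma critical_returns:
  assumes fib: "\<And>k. 1 \<le> k \<Longrightarrow> fib_nest k" and k: "1 \<le> k"
  shows "(f ^^ S (Suc k)) c \<in> nest k \<inter> D f (nest k)"
proof -
  have "(f ^^ S (Suc k)) c \<in> nest k"
    using iter_mem_nest[OF fib[OF k] c_in] fib_nest_critical[OF fib k] by simp
  moreover have "(f ^^ S (Suc (Suc k))) c \<in> nest k"
    using iter_mem_nest[OF fib[OF k] c_in] fib_nest_critical[OF fib, of "Suc k"]
      level_mono[OF fib k, of "Suc k"] by auto
  then have "(f ^^ S k) ((f ^^ S (Suc k)) c) \<in> nest k"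
    using iter_add[of "S k" "S (Suc k)" c] by (simp add: add.commute)
  then have "(f ^^ S (Suc k)) c \<in> D f (nest k)"
    unfolding D_def using iter_in[OF c_in] S_pos by blast
  ultimately show ?thesis by blast
qed

text \<open>Strong induction on the time. Before \<open>S (Suc (Suc k))\<close> only the times
  \<open>0\<close> and \<open>S (Suc k)\<close> are possible; a later visit lies in the same return
  domain as the visit obtained by removing the largest Fibonacci number from the time.\<close>

lemma orbit_in_two_components:
  assumes fib: "\<And>k. 1 \<le> k \<Longrightarrow> fib_nest k" and far: "\<And>k. 1 \<le> k \<Longrightarrow> (f ^^ S k) c \<notin> nest k"
    and k: "1 \<le> k"
    and C: "C0 \<in> return_domains f (nest k)" "c \<in> C0"
      "C1 \<in> return_domains f (nest k)" "(f ^^ S (Suc k)) c \<in> C1"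
    and i: "(f ^^ i) c \<in> nest k"
  shows "(f ^^ i) c \<in> C0 \<union> C1"
  using i
proof (induction i rule: less_induct)
  case (less i)
  have c_bounds': "level m < f c" if "1 \<le> m" for m
    using fib_nest_bounds[OF fib[OF that]] by simp
  have orbit: "(f ^^ j) c \<in> nest m \<longleftrightarrow> level m < (f ^^ j) (f c)" if "1 \<le> m" for j m
    using iter_mem_nest[OF fib[OF that] c_in] .
  consider "i = 0" | "0 < i" "i < S (Suc k)" | "i = S (Suc k)" | "S (Suc k) < i" "i < S (Suc (Suc k))"
    | "S (Suc (Suc k)) \<le> i" by linarith
  then show ?case
  proof cases
    case 1
    then show ?thesis using C by simp
  next
    case 2
    have "return_level (level k) (S (Suc k)) (level (Suc k))"
      using fib k by (intro fib_nest_return) auto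
    then have "(f ^^ i) (f c) \<le> level k"
      using 2 unfolding return_level_def by force
    then show ?thesis using less.prems orbit[OF k] by simp
  next
    case 3
    then show ?thesis using C by simp
  next
    case 4
    have "(f ^^ (i - S (Suc k))) ((f ^^ S (Suc k)) (f c)) \<le> level k"
      using 4 f_le_max[OF iter_in[OF c_in], of "S (Suc k)"] iter_Suc[of "S (Suc k)" c]
      by (intro fib_nest_between[OF k fib[OF k] fib_nest_critical[OF fib k]]) auto
    then show ?thesis
      using less.prems orbit[OF k, of i] iter_add[of "i - S (Suc k)" "S (Suc k)" "f c"] 4 by simp
  next
    case 5
    \<comment> \<open>Both \<open>c\<close> and its iterate at time \<open>S m\<close> are in
      \<open>nest (m - 1)\<close>, and the remaining time \<open>i - S m\<close> is less than
      \<open>S (m - 1)\<close>. So the iterates at times \<open>i - S m\<close> and \<open>i\<close>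
      share a connected subset of the domain.\<close>
    then obtain m where m: "Suc (Suc k) \<le> m" "S m \<le> i" "i < S (Suc m)" by (rule S_interval)
    then obtain n where n: "m = Suc (Suc n)" "k \<le> n" by (cases m; cases "m - 1") auto
    define j where "j = i - S m"
    have j: "i = j + S m" "j < S (Suc n)" "j < i"
      using m n S_pos[of m] by (auto simp: j_def)
    let ?x = "(f ^^ S m) c"
    have x: "?x \<in> nest (Suc n)" "c \<in> nest (Suc n)"
      using critical_returns[OF fib, of "Suc n"] n orbit[of "Suc n" 0] c_bounds'[of "Suc n"] by auto
    have "(f ^^ j) ?x \<in> nest k" using less.prems j iter_add[of j "S m" c] by simp
    then have A: "(f ^^ j) ` nest (Suc n) \<subseteq> nest k \<inter> D f (nest k)"
      using iterated_nest_in_domain[OF fib k(1) n(2) j(2) x(1)] by simp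
    have "nest (Suc n) = superlevel (level (Suc n))" using fib_nest_superlevel fib by simp
    then have "connected (nest (Suc n))" "nest (Suc n) \<subseteq> {0..1}"
      using fib_nest_bounds[OF fib, of "Suc n"] connected_superlevel[of "level (Suc n)"]
      by (auto simp: superlevel_def)
    then have conn: "connected ((f ^^ j) ` nest (Suc n))"
      by (intro connected_continuous_image continuous_on_subset[OF cont_iter]) auto
    have img: "(f ^^ j) c \<in> (f ^^ j) ` nest (Suc n)" "(f ^^ i) c \<in> (f ^^ j) ` nest (Suc n)"
      using x j iter_add[of j "S m" c] by force+
    then have "(f ^^ j) c \<in> C0 \<union> C1" using less.IH[OF j(3)] A by blast
    then obtain C where "C \<in> {C0, C1}" "(f ^^ j) c \<in> C" by blast
    moreover from this have "(f ^^ j) ` nest (Suc n) \<subseteq> C"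
      using components_maximal[OF _ conn A, of C] C img unfolding return_domains_def by blast
    ultimately show ?thesis using img by blast
  qed
qed

text \<open>Let \<open>n\<close> be the first time at which some point of \<open>C\<close> enters.
  If another point did not enter then, some point of \<open>C\<close> would have value exactly
  \<open>t\<close> at time \<open>n\<close>; it has not entered before and cannot enter
  later.\<close>

lemma entry_time_constant:
  assumes nice: "nice_level t" and C: "connected C" "C \<subseteq> superlevel t \<inter> D f (superlevel t)"
    and xy: "x \<in> C" "y \<in> C"
  shows "entry_time f (superlevel t) x = entry_time f (superlevel t) y"
proof -
  let ?P = "\<lambda>n. 1 \<le> n \<and> (\<exists>z\<in>C. t < (f ^^ n) (f z))"
  define n where "n = (LEAST n. ?P n)"
  have C01: "C \<subseteq> {0..1}" using C by (auto simp: superlevel_def)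
  have ret: "\<exists>k\<ge>1. t < (f ^^ k) (f z)" if "z \<in> C" for z
    using C(2) that unfolding D_superlevel by blast
  then have "\<exists>n. ?P n" using xy by blast
  then have "?P n" unfolding n_def by (rule LeastI_ex)
  then obtain z where n: "1 \<le> n" and z: "z \<in> C" "t < (f ^^ n) (f z)" by blast
  have min: "(f ^^ i) (f w) \<le> t" if "w \<in> C" "1 \<le> i" "i < n" for w i
    using not_less_Least[of i ?P] that unfolding n_def[symmetric] by force
  have "entry_time f (superlevel t) w = n" if w: "w \<in> C" for w
  proof -
    have "t < (f ^^ n) (f w)"
    proof (rule ccontr)
      assume "\<not> t < (f ^^ n) (f w)"
      then obtain v where v: "v \<in> C" "(f ^^ n) (f v) = t"
        using iter_ivt[OF w z(1) C01 C(1), of "Suc n" t] z iter_Suc by force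
      obtain k where k: "1 \<le> k" "t < (f ^^ k) (f v)" using ret v by blast
      then have "n \<le> k" using min[OF v(1)] by (meson not_le)
      then have "(f ^^ k) (f v) = (f ^^ (k - n)) t"
        using iter_add[of "k - n" n "f v"] v by simp
      then show False using k nice by (simp add: nice_level_def not_less[symmetric])
    qed
    then show ?thesis using w C01 n min by (intro entry_time_eq) auto
  qed
  then show ?thesis using xy by simp
qed

text \<open>The second domain is the component of \<open>b\<close>, the first return of
  \<open>c\<close>. It differs from \<open>nest (Suc k)\<close> by (3) for \<open>Suc k\<close>, and
  its return time need only be computed at \<open>b\<close>.\<close>

lemma fib_nest_imp_return_structure:
  assumes fib: "\<And>k. 1 \<le> k \<Longrightarrow> fib_nest k" and far: "\<And>k. 1 \<le> k \<Longrightarrow> (f ^^ S k) c \<notin> nest k"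
    and k: "1 \<le> k"
  shows "\<exists>C0 C1. ({C \<in> return_domains f (nest k). C \<inter> forward_orbit f c \<noteq> {}} = {C0, C1} \<and>
        C0 \<noteq> C1 \<and> C0 = nest (k + 1)) \<and>
       ((\<forall>x\<in>C0. first_entry f (nest k) x = (f ^^ S (k + 1)) x) \<and>
        (\<forall>x\<in>C1. first_entry f (nest k) x = (f ^^ S k) x)) \<and>
       (f ^^ S k) c \<notin> nest k"
proof -
  define X where "X = nest k \<inter> D f (nest k)"
  define b where "b = (f ^^ S (Suc k)) c"
  define C1 where "C1 = connected_component_set X b"
  have nice: "nice_level (level k)" and nest_k: "nest k = superlevel (level k)"
    using fib[OF k] by (auto simp: fib_nest_def superlevel_nest_def)
  have ret: "return_level (level k) (S (Suc k)) (level (Suc k))"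
    using fib k by (intro fib_nest_return) auto
  have nest_Suc_k: "nest (Suc k) = superlevel (level (Suc k))" using fib_nest_superlevel fib by simp
  have c: "c \<in> nest (Suc k)"
    unfolding nest_Suc_k using fib_nest_bounds[OF fib, of "Suc k"] c_in by (simp add: superlevel_def)
  have C0: "nest (Suc k) \<in> return_domains f (nest k)"
    using central_return_domain_iff[of "nest (Suc k)" f c "nest k"] nest_Suc[OF k] c by auto
  have b: "b \<in> X" unfolding b_def X_def by (rule critical_returns[OF fib k])
  then have b1: "b \<in> C1" unfolding C1_def by (auto intro: connected_component_refl)
  have C1: "C1 \<in> return_domains f (nest k)"
    unfolding return_domains_def C1_def X_def[symmetric] using b by (rule componentsI)
  have b0: "b \<notin> nest (Suc k)" unfolding b_def using far by simp
  have orb: "c \<in> forward_orbit f c" "b \<in> forward_orbit f c"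
    unfolding forward_orbit_def b_def by (auto intro: exI[of _ 0])
  have "C \<in> {nest (Suc k), C1}" if C: "C \<in> return_domains f (nest k)" "C \<inter> forward_orbit f c \<noteq> {}" for C
  proof -
    obtain i where i: "(f ^^ i) c \<in> C" using C unfolding forward_orbit_def by blast
    then have "(f ^^ i) c \<in> nest k"
      using C(1) in_components_subset unfolding return_domains_def by blast
    then have "(f ^^ i) c \<in> nest (Suc k) \<union> C1"
      using orbit_in_two_components[OF fib far k C0 c C1] b1 by (simp add: b_def)
    then show ?thesis
      using i C(1) C0 C1 components_nonoverlap unfolding return_domains_def by blast
  qed
  then have "{C \<in> return_domains f (nest k). C \<inter> forward_orbit f c \<noteq> {}} = {nest (Suc k), C1}"
    using C0 C1 c b1 orb by blast
  moreover have "nest (Suc k) \<noteq> C1" using b0 b1 by blast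
  moreover have "first_entry f (nest k) x = (f ^^ S (Suc k)) x" if "x \<in> nest (Suc k)" for x
  proof -
    have x: "x \<in> {0..1}" "level (Suc k) < f x" "f x \<le> f c"
      using that f_le_max by (auto simp: nest_Suc_k superlevel_def)
    then have "entry_time f (nest k) x = S (Suc k)"
      unfolding nest_k using ret S_pos by (intro entry_time_eq) (auto simp: return_level_def)
    then show ?thesis by (simp add: first_entry_def)
  qed
  moreover have "first_entry f (nest k) x = (f ^^ S k) x" if x: "x \<in> C1" for x
  proof -
    have fb: "f b = (f ^^ S (Suc k)) (f c)" by (simp add: b_def iter_Suc)
    have b01: "b \<in> {0..1}" unfolding b_def by (rule iter_in[OF c_in])
    have "level k < (f ^^ S (Suc (Suc k))) (f c)"
      using fib_nest_critical[OF fib, of "Suc k"] level_mono[OF fib k, of "Suc k"] by simp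
    then have "level k < (f ^^ S k) (f b)"
      unfolding fb using iter_add[of "S k" "S (Suc k)" "f c"] by (simp add: add.commute)
    moreover have "(f ^^ i) (f b) \<le> level k" if "1 \<le> i" "i < S k" for i
      using fib_nest_critical[OF fib k] f_le_max[OF b01] that unfolding fb[symmetric]
      by (intro fib_nest_between[OF k fib[OF k]]) auto
    ultimately have "entry_time f (nest k) b = S k"
      unfolding nest_k using b01 S_pos by (intro entry_time_eq) auto
    moreover have "entry_time f (nest k) x = entry_time f (nest k) b"
      using entry_time_constant[OF nice in_components_connected in_components_subset x b1] C1
      unfolding nest_k return_domains_def by blast
    ultimately show ?thesis by (simp add: first_entry_def)
  qed
  ultimately show ?thesis using far[OF k] unfolding Suc_eq_plus1[symmetric] by blast
qed

subsection \<open>From the return structure to closest preimages\<close>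

text \<open>A coincidence at times \<open>i < j\<close> lets every time \<open>l \<ge> j\<close> be
  lowered to \<open>l - j + i\<close>, so the orbit would consist of its first \<open>j\<close>
  points.\<close>

lemma infinite_orbit_inj:
  assumes inf: "infinite (forward_orbit f c)" and eq: "(f ^^ i) c = (f ^^ j) c"
  shows "i = j"
proof -
  have "\<not> i < j" if "(f ^^ i) c = (f ^^ j) c" for i j
  proof
    assume less: "i < j"
    have "(f ^^ l) c \<in> (\<lambda>l. (f ^^ l) c) ` {..<j}" for l
    proof (induction l rule: less_induct)
      case (less l)
      show ?case
      proof (cases "l < j")
        case False
        then have "(f ^^ l) c = (f ^^ (l - j + i)) c"
          using iter_add[of "l - j" j c] iter_add[of "l - j" i c] that by simp
        then show ?thesis using less[of "l - j + i"] False \<open>i < j\<close> by simp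
      qed auto
    qed
    then have "forward_orbit f c \<subseteq> (\<lambda>l. (f ^^ l) c) ` {..<j}" unfolding forward_orbit_def by blast
    then show False using inf finite_subset by blast
  qed
  from this[OF eq] this[OF eq[symmetric]] show ?thesis by simp
qed

text \<open>Property (2) equates maps, not times. Evaluated at \<open>c\<close>, it gives two times
  with the same iterate of \<open>c\<close>, and they agree once the critical orbit is known to be
  infinite.\<close>

lemma return_structure_imp_fib_nest:
  assumes dom: "\<And>k. 1 \<le> k \<Longrightarrow> nest (Suc k) \<in> return_domains f (nest k)"
    and entry: "\<And>k x. 1 \<le> k \<Longrightarrow> x \<in> nest (Suc k) \<Longrightarrow> first_entry f (nest k) x = (f ^^ S (Suc k)) x"
    and far: "\<And>k. 1 \<le> k \<Longrightarrow> (f ^^ S k) c \<notin> nest k"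
    and k: "1 \<le> k"
  shows "fib_nest k"
proof -
  have return: "\<exists>n\<ge>1. superlevel_nest (Suc k) \<and> return_level (level k) n (level (Suc k)) \<and>
      entry_time f (nest k) c = n \<and> level k < (f ^^ n) (f c)"
    if k: "1 \<le> k" "superlevel_nest k" for k
  proof -
    \<comment> \<open>Being a return domain excludes the default value \<open>{}\<close>, so
      \<open>c\<close> does return.\<close>
    have "central_return_domain f c (nest k) \<noteq> {}"
      using dom[OF k(1)] nest_Suc[OF k(1)] in_components_nonempty unfolding return_domains_def by metis
    then have "c \<in> nest k \<inter> D f (nest k)"
      using connected_component_eq_empty unfolding central_return_domain_def by blast
    then have ex: "\<exists>n. 1 \<le> n \<and> level k < (f ^^ n) (f c)"
      using k(2) by (auto simp: superlevel_nest_def D_superlevel)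
    define n where "n = (LEAST n. 1 \<le> n \<and> level k < (f ^^ n) (f c))"
    have n: "1 \<le> n" "level k < (f ^^ n) (f c)"
      using LeastI_ex[OF ex] unfolding n_def by blast+
    have first: "(f ^^ i) (f c) \<le> level k" if "1 \<le> i" "i < n" for i
      using not_less_Least[OF that(2)[unfolded n_def]] that(1) by simp
    have "entry_time f (nest k) c = n"
      using entry_time_eq[OF c_in n first] k(2) by (simp add: superlevel_nest_def)
    then show ?thesis using superlevel_nest_Suc[OF k n first] n by blast
  qed
  have sup: "superlevel_nest k" if "1 \<le> k" for k
    using that
  proof (induction k rule: dec_induct)
    case base
    show ?case by (rule superlevel_nest_1)
  next
    case (step k)
    then show ?case using return[of k] by blast
  qed
  have nest_eq: "nest k = superlevel (level k)" and lt: "level k < f c" if "1 \<le> k" for k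
    using sup[OF that] by (auto simp: superlevel_nest_def nice_level_def)
  have mono: "nest j \<subseteq> nest i" if "1 \<le> i" "i \<le> j" for i j
    using that(2)
  proof (induction j rule: dec_induct)
    case (step j)
    then have "level j \<le> level (Suc j)"
      using return[of j] sup that unfolding return_level_def by force
    then have "nest (Suc j) \<subseteq> nest j"
      using superlevel_antimono nest_eq step that by simp
    then show ?case using step.IH by blast
  qed simp
  have time: "(f ^^ entry_time f (nest k) c) c = (f ^^ S (Suc k)) c" if "1 \<le> k" for k
    using entry[OF that, of c] nest_eq[of "Suc k"] lt[of "Suc k"] c_in that
    by (simp add: superlevel_def first_entry_def)
  have mem: "(f ^^ S (Suc k)) c \<in> nest k" if k: "1 \<le> k" for k
  proof -
    obtain n where "entry_time f (nest k) c = n" "level k < (f ^^ n) (f c)"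
      using return[OF k sup[OF k]] by blast
    then have "(f ^^ entry_time f (nest k) c) c \<in> nest k"
      using nest_eq[OF k] iter_in_superlevel[OF c_in] iter_Suc by simp
    then show ?thesis using time[OF k] by simp
  qed
  \<comment> \<open>The later point is in \<open>nest (Suc (Suc i))\<close>, the earlier one is not,
    by (3).\<close>
  have "(f ^^ S (Suc (Suc i))) c \<noteq> (f ^^ S (Suc (Suc j))) c" if "i < j" for i j
  proof -
    have "(f ^^ S (Suc (Suc j))) c \<in> nest (Suc (Suc i))"
      using mem[of "Suc j"] mono[of "Suc (Suc i)" "Suc j"] that by auto
    then show ?thesis using far[of "Suc (Suc i)"] by auto
  qed
  then have "inj (\<lambda>i. (f ^^ S (Suc (Suc i))) c)"
    by (metis (mono_tags, lifting) injI linorder_neqE_nat)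
  then have "infinite (range (\<lambda>i. (f ^^ S (Suc (Suc i))) c))"
    by (rule range_inj_infinite)
  moreover have "range (\<lambda>i. (f ^^ S (Suc (Suc i))) c) \<subseteq> forward_orbit f c"
    unfolding forward_orbit_def by blast
  ultimately have "infinite (forward_orbit f c)" using infinite_super by blast
  then have time_eq: "entry_time f (nest k) c = S (Suc k)" if "1 \<le> k" for k
    using infinite_orbit_inj time[OF that] by blast
  have "return_level (level (k - 1)) (S k) (level k)" if two: "2 \<le> k"
  proof -
    obtain l where "k = Suc l" "1 \<le> l" using two by (cases k) auto
    then show ?thesis using return[of l] sup time_eq by auto
  qed
  then show ?thesis using sup[OF k] by (simp add: fib_nest_def)
qed

lemma no_preimage_above_level:
  assumes fib: "1 \<le> k" "fib_nest k" and j: "1 \<le> j" "j < S k" and x: "x \<in> {0..1}" "(f ^^ j) x = c"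
  shows "f x \<le> level k"
proof (rule ccontr)
  assume "\<not> f x \<le> level k"
  then have "(f ^^ j) (f x) \<le> level k"
    using f_le_max[OF x(1)] by (intro fib_nest_between[OF fib _ _ j]) auto
  then show False using x(2) iter_Suc[of j x] fib_nest_bounds[OF fib(2)] by simp
qed

text \<open>Otherwise \<open>f ^^ S k\<close> is injective, hence monotone, on
  \<open>{level k..f c}\<close>. Its values at both ends are at most \<open>level k\<close>, but at
  the interior point \<open>w\<close> it takes the value of \<open>f c\<close> at time
  \<open>S (Suc (Suc k))\<close>, which is larger.\<close>

lemma preimage_above_level:
  assumes fib: "\<And>k. 1 \<le> k \<Longrightarrow> fib_nest k" and far: "(f ^^ S k) c \<notin> nest k" and k: "1 \<le> k"
  shows "\<exists>x\<in>{0..1}. (f ^^ S k) x = c \<and> level k < f x"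
proof (rule ccontr)
  assume none: "\<not> ?thesis"
  have bounds: "0 \<le> level k" "level k < f c" "f c \<le> 1"
    using fib_nest_bounds[OF fib[OF k]] max_in by auto
  have "(f ^^ j) v \<noteq> c" if v: "level k < v" "v < f c" and j: "j < S k" for v j
  proof
    assume eq: "(f ^^ j) v = c"
    obtain x where x: "x \<in> {0..1}" "f x = v" using f_attains[of v] v bounds by auto
    then have fx: "(f ^^ Suc j) x = c" using eq iter_Suc[of j x] by simp
    show False
    proof (cases "Suc j = S k")
      case True
      then show ?thesis using none x fx v by auto
    next
      case False
      then have "f x \<le> level k"
        using j x fx by (intro no_preimage_above_level[OF k fib[OF k], of "Suc j"]) auto
      then show ?thesis using x v by simp
    qed
  qed
  then have inj: "inj_on (f ^^ S k) {level k..f c}"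
    using bounds by (intro iter_inj) auto
  define w where "w = (f ^^ S (Suc k)) (f c)"
  have "(f ^^ S k) w = (f ^^ S (Suc (Suc k))) (f c)"
    unfolding w_def using iter_add[of "S k" "S (Suc k)" "f c"] by (simp add: add.commute)
  also have "level k < \<dots>"
    using fib_nest_critical[OF fib, of "Suc k"] level_mono[OF fib k, of "Suc k"] by simp
  finally have fw: "level k < (f ^^ S k) w" .
  have far': "(f ^^ S k) (f c) \<le> level k"
    using far iter_mem_nest[OF fib[OF k] c_in, of "S k"] by simp
  have "w \<le> f c"
    unfolding w_def using f_le_max[OF iter_in[OF c_in, of "S (Suc k)"]] iter_Suc by simp
  moreover have "w \<noteq> f c" using fw far' by auto
  moreover have "level k < w" unfolding w_def by (rule fib_nest_critical[OF fib k])
  ultimately show False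
    using iter_mono[OF bounds(1,3) _ _ inj, of w] fw far' fib_nest_nice[OF fib[OF k], of "S k"] by auto
qed

text \<open>Eliminates \<open>hat\<close>: the segment at \<open>p l\<close> is the superlevel set
  of \<open>f (p l)\<close>, so the \<open>T i\<close> are the times at which \<open>f (p k)\<close>
  sets a record.\<close>

lemma closest_times_iff:
  assumes near: "\<And>k. nearest_preimage f c k (p k)"
  shows "closest_times p hat T \<longleftrightarrow> T 0 = 1 \<and>
    (\<forall>i. T i \<le> T (Suc i) \<and> f (p (T i)) < f (p (T (Suc i))) \<and>
      (\<forall>k\<ge>T i. f (p (T i)) < f (p k) \<longrightarrow> T (Suc i) \<le> k))"
proof -
  have p: "p k \<in> {0..1}" for k using near unfolding nearest_preimage_def by blast
  have "p k \<in> open_segment (p l) (hat (p l)) \<longleftrightarrow> f (p l) < f (p k)" for k l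
    unfolding open_segment_hat[OF p] using p[of k] by (simp add: superlevel_def)
  then show ?thesis unfolding closest_times_def Let_def by auto
qed

text \<open>The values \<open>level k\<close> separate \<open>f (p (S k))\<close> from all
  \<open>f (p j)\<close> with \<open>1 \<le> j < S k\<close>. A closer \<open>p k\<close> with
  \<open>S i < k < S (Suc i)\<close> would be mapped by \<open>f ^^ S i\<close> into
  \<open>nest (i - 1)\<close>, to a preimage of \<open>c\<close> of order less than
  \<open>S (i - 1)\<close>.\<close>

lemma fib_nest_imp_fibonacci_map:
  assumes fib: "\<And>k. 1 \<le> k \<Longrightarrow> fib_nest k" and far: "\<And>k. 1 \<le> k \<Longrightarrow> (f ^^ S k) c \<notin> nest k"
  shows "fibonacci_map f c hat"
proof -
  obtain p where near: "\<And>k. nearest_preimage f c k (p k)"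
    using nearest_preimage_exists by metis
  then have p: "p k \<in> {0..1}" "(f ^^ k) (p k) = c" for k
    unfolding nearest_preimage_def by blast+
  have above: "level k < f (p (S k))" if k: "1 \<le> k" for k
  proof -
    obtain x where "x \<in> {0..1}" "(f ^^ S k) x = c" "level k < f x"
      using preimage_above_level[OF fib far[OF k] k] by blast
    then show ?thesis using nearest_preimage_maximal[OF near S_pos] by fastforce
  qed
  have below: "f (p j) \<le> level k" if "1 \<le> k" "1 \<le> j" "j < S k" for j k
    using no_preimage_above_level[OF that(1) fib that(2,3)] that p by simp
  have "S (Suc i) \<le> k" if k: "S i \<le> k" "f (p (S i)) < f (p k)" for i k
  proof (rule ccontr)
    assume less: "\<not> S (Suc i) \<le> k"
    have "k \<noteq> S i" using k by auto
    \<comment> \<open>No integer lies strictly between \<open>S i\<close> and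
      \<open>S (Suc i)\<close> for \<open>i = 0\<close> or \<open>i = 1\<close>.\<close>
    then obtain h where h: "i = Suc (Suc h)"
      using less k by (cases i rule: S.cases) auto
    define j where "j = k - S i"
    have j: "k = j + S i" "1 \<le> j" "j < S (Suc h)"
      using k less \<open>k \<noteq> S i\<close> h unfolding j_def by auto
    have ret: "return_level (level (Suc h)) (S i) (level i)"
      unfolding h using fib by (intro fib_nest_return) auto
    let ?x = "(f ^^ S i) (p k)"
    have "level i < f (p k)" using above[of i] k h by simp
    then have "level (Suc h) < (f ^^ S i) (f (p k))"
      using ret f_le_max[OF p(1), of k] unfolding return_level_def by blast
    then have "level (Suc h) < f ?x" using iter_Suc[of "S i" "p k"] by simp
    moreover have "f ?x \<le> level (Suc h)"
      using iter_in[OF p(1)] p(2)[of k] j iter_add[of j "S i" "p k"]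
      by (intro no_preimage_above_level[OF _ fib j(2,3)]) auto
    ultimately show False by simp
  qed
  moreover have "f (p (S i)) < f (p (S (Suc i)))" for i
    using below[of "Suc i" "S i"] above[of "Suc i"] S_pos S_less_Suc[of i] by fastforce
  ultimately have "closest_times p hat S"
    unfolding closest_times_iff[OF near] using S_less_Suc by (auto simp: less_imp_le)
  then show ?thesis unfolding fibonacci_map_def using near by blast
qed

end

subsection \<open>Critical values of Fibonacci maps\<close>

locale fibonacci_preimages = symmetric_unimodal +
  fixes p :: "nat \<Rightarrow> real"
  assumes near: "nearest_preimage f c k (p k)"
    and closer: "f (p (S i)) < f (p (S (Suc i)))"
    and first_closer: "S i \<le> k \<Longrightarrow> f (p (S i)) < f (p k) \<Longrightarrow> S (Suc i) \<le> k"
begin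

definition r :: "nat \<Rightarrow> real" where
  "r i = f (p (S i))"

lemma p_in: "p k \<in> {0..1}" and iter_p: "(f ^^ k) (p k) = c"
  using near unfolding nearest_preimage_def by blast+

lemma r_increasing: "r i < r (Suc i)"
  using closer by (simp add: r_def)

lemma r_bounds: "0 \<le> r i" "r i < f c"
  using f_in[OF p_in] f_le_max[OF p_in, of "S (Suc i)"] r_increasing[of i] by (auto simp: r_def)

lemma r_0: "r 0 = c"
  using iter_p[of 1] by (simp add: r_def)

lemma iter_r: "Suc m = S i \<Longrightarrow> (f ^^ m) (r i) = c"
  using iter_p[of "S i"] iter_Suc[of m] by (simp add: r_def)

lemma iter_r_max: "(f ^^ S i) (r i) = f c"
  using iter_p[of "S i"] iter_Suc[of "S i"] by (simp add: r_def)

text \<open>The value \<open>v\<close> is the image of a preimage of \<open>c\<close> of order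
  \<open>Suc j\<close>, hence the shift by one. Among orders below \<open>S (Suc i)\<close> the last
  record of \<open>f (p k)\<close> is \<open>r i\<close>.\<close>

lemma preimage_le_r:
  assumes "0 \<le> v" "v \<le> f c" "(f ^^ j) v = c" "Suc j < S (Suc i)"
  shows "v \<le> r i"
proof -
  obtain x where x: "x \<in> {0..1}" "f x = v" using f_attains assms by blast
  have "(f ^^ Suc j) x = c" using assms x iter_Suc[of j x] by simp
  then have "v \<le> f (p (Suc j))"
    using nearest_preimage_maximal[OF near, of "Suc j" x] x by simp
  also have "\<dots> \<le> r i"
    using assms(4)
  proof (induction i)
    case 0
    then show ?case by (simp add: r_def)
  next
    case (Suc i)
    show ?case
    proof (cases "Suc j < S (Suc i)")
      case True
      then show ?thesis using Suc.IH r_increasing[of i] by simp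
    next
      case False
      then show ?thesis using first_closer[of "Suc i" "Suc j"] Suc.prems by (force simp: r_def)
    qed
  qed
  finally show ?thesis .
qed

lemma inj_on_r:
  assumes "m < S (Suc i)"
  shows "inj_on (f ^^ m) {r i..f c}"
proof (rule iter_inj)
  fix v j assume "r i < v" "v < f c" "j < m"
  then show "(f ^^ j) v \<noteq> c"
    using preimage_le_r[of v j i] r_bounds[of i] assms by force
qed (use r_bounds max_in in auto)

text \<open>Otherwise \<open>f ^^ S ?k\<close> takes the value \<open>r i\<close> at some
  \<open>w\<close> in \<open>{r ?k..f c}\<close>. As \<open>r i\<close> reaches \<open>c\<close>
  after \<open>S i - 1\<close> steps, \<open>w\<close> belongs to a preimage of order
  \<open>S i + S ?k < S (Suc ?k)\<close>, which forces \<open>w = r ?k\<close>; but there the value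
  is \<open>f c\<close>.\<close>

lemma critical_value_above:
  "r i < (f ^^ S (Suc (Suc i))) (f c)"
proof (rule ccontr)
  let ?k = "Suc (Suc i)"
  assume "\<not> ?thesis"
  then have le: "(f ^^ S ?k) (f c) \<le> r i \<and> r i \<le> (f ^^ S ?k) (r ?k)"
    unfolding iter_r_max using r_bounds[of i] by simp
  obtain w where w: "r ?k \<le> w" "w \<le> f c" "(f ^^ S ?k) w = r i"
    by (rule iter_ivt_interval[OF _ _ _ disjI2[OF le]]) (use r_bounds[of ?k] max_in in auto)
  obtain m where m: "Suc m = S i" using S_pos[of i] by (cases "S i") auto
  have "(f ^^ (m + S ?k)) w = c"
    using iter_add[of m "S ?k" w] w(3) iter_r[OF m] by simp
  moreover have "Suc (m + S ?k) < S (Suc ?k)" using m S_less_Suc[of i] by simp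
  ultimately have "w \<le> r ?k"
    using preimage_le_r[of w "m + S ?k" ?k] w r_bounds[of ?k] by simp
  then have "w = r ?k" using w by simp
  then show False using w(3) iter_r_max[of ?k] r_bounds[of i] by simp
qed

text \<open>On \<open>{r ?k..f c}\<close> the map \<open>f ^^ S ?k\<close> is injective with its
  maximum \<open>f c\<close> at the left end, so it decreases. Its value at
  \<open>r (Suc ?k)\<close> is the image under \<open>f\<close> of an \<open>S i\<close>-th preimage
  of \<open>c\<close>, hence at most \<open>r i\<close>.\<close>

lemma critical_value_below:
  "(f ^^ S (Suc i)) (f c) < r i"
proof -
  let ?k = "Suc i"
  have inj: "inj_on (f ^^ S ?k) {r ?k..f c}" by (rule inj_on_r[OF S_less_Suc])
  have y: "(f ^^ S ?k) (r (Suc ?k)) = f ((f ^^ S ?k) (p (S (Suc ?k))))"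
    by (simp add: r_def funpow_swap1 del: S.simps)
  then have "(f ^^ S ?k) (r (Suc ?k)) \<le> f c"
    using f_le_max[OF iter_in[OF p_in]] by simp
  then have "(f ^^ S ?k) (f c) < (f ^^ S ?k) (r (Suc ?k))"
    using iter_mono[OF _ _ _ _ inj, of "r (Suc ?k)"] r_bounds[of ?k] r_bounds[of "Suc ?k"]
      r_increasing[of ?k] max_in iter_r_max[of ?k] by auto
  also have "(f ^^ S i) ((f ^^ S ?k) (p (S (Suc ?k)))) = c"
    using iter_add[of "S i" "S ?k" "p (S (Suc ?k))"] iter_p[of "S (Suc ?k)"] by (simp add: add.commute)
  then have "f ((f ^^ S ?k) (p (S (Suc ?k)))) \<le> f (p (S i))"
    by (intro nearest_preimage_maximal[OF near S_pos] iter_in[OF p_in])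
  then have "(f ^^ S ?k) (r (Suc ?k)) \<le> r i" unfolding y by (simp add: r_def)
  finally show ?thesis .
qed

text \<open>There is no turning point between \<open>r i\<close> and \<open>r (Suc i)\<close>, and
  the largest possible value \<open>f c\<close> is attained at the right end.\<close>

lemma iter_increasing:
  assumes "r i \<le> x" "x \<le> y" "y \<le> r (Suc i)"
  shows "(f ^^ S (Suc i)) x \<le> (f ^^ S (Suc i)) y"
proof -
  let ?k = "Suc i"
  obtain m where m: "Suc m = S ?k" using S_pos[of ?k] by (cases "S ?k") auto
  have inj_m: "inj_on (f ^^ m) {r i..f c}" by (rule inj_on_r) (use m in simp)
  have "inj_on (f ^^ S ?k) {r i..r ?k}"
  proof (rule iter_inj)
    fix v j assume v: "r i < v" "v < r ?k" and j: "j < S ?k"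
    show "(f ^^ j) v \<noteq> c"
    proof
      assume eq: "(f ^^ j) v = c"
      show False
      proof (cases "Suc j < S ?k")
        case True
        then show ?thesis using preimage_le_r[of v j i] eq v r_bounds[of i] r_bounds[of ?k] by simp
      next
        case False
        \<comment> \<open>At the last order, injectivity of \<open>f ^^ m\<close> shows that
          \<open>r ?k\<close> is the only point mapped to \<open>c\<close>.\<close>
        then have "j = m" using j m by simp
        then have "v = r ?k"
          using inj_onD[OF inj_m, of v "r ?k"] eq iter_r[OF m] v r_bounds[of ?k] by simp
        then show ?thesis using v by simp
      qed
    qed
  qed (use r_bounds[of i] r_bounds[of ?k] max_in in auto)
  then have inj: "inj_on (f ^^ S ?k) {x..r ?k}" by (rule inj_on_subset) (use assms in auto)
  have x01: "0 \<le> x" "r ?k \<le> 1" using assms r_bounds[of i] r_bounds[of ?k] max_in by auto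
  have "f c = (f ^^ S ?k) (r ?k)" using iter_r_max by simp
  moreover have "(f ^^ S ?k) z \<le> f c" if "z \<in> {0..1}" for z
    using f_le_max[OF iter_in[OF that, of "S ?k - 1"]] S_pos[of ?k]
    by (cases "S ?k") (auto simp del: S.simps)
  ultimately show ?thesis
    using iter_mono[OF x01 _ _ inj, of y] assms x01 by (cases "x = y"; cases "y = r ?k") force+
qed

text \<open>Interleaving turns the bounds on critical values in terms of \<open>r\<close> into
  bounds by \<open>level\<close>, which fix the first return time of \<open>c\<close>. The clause on
  \<open>k - 1\<close> serves the times between \<open>S k\<close> and
  \<open>S (Suc k)\<close>.\<close>

lemma nest_interleaved:
  assumes "1 \<le> k"
  shows "fib_nest k \<and> (2 \<le> k \<longrightarrow> fib_nest (k - 1)) \<and> r (k - 1) < level k \<and> level k < r k"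
  using assms
proof (induction k rule: dec_induct)
  case base
  have "f (r 1) = c" using iter_r[of 1 1] by simp
  moreover have "c < r 1" using r_increasing[of 0] r_0 by simp
  ultimately have "q < r 1"
    using f_decreasing[of "r 1" q] c_bounds fixed_q by (cases "r 1" q rule: linorder_cases) auto
  then show ?case using fib_nest_1 level_1 r_0 c_bounds by simp
next
  case (step k)
  then have fib: "fib_nest k" and fib': "2 \<le> k \<Longrightarrow> fib_nest (k - 1)"
    and lo: "r (k - 1) < level k" and hi: "level k < r k" by auto
  obtain i where k: "k = Suc i" using step(1) by (cases k) auto
  have top: "f c \<le> 1" using max_in by simp
  \<comment> \<open>Otherwise \<open>?w\<close> is between \<open>r i\<close> and
    \<open>level k\<close>, and by \<open>iter_increasing\<close> its \<open>S k\<close>-th iterate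
    is at most \<open>level k\<close>. That iterate exceeds \<open>r k\<close> by
    \<open>critical_value_above\<close>.\<close>
  have returns: "level k < (f ^^ S (Suc k)) (f c)"
  proof (rule ccontr)
    let ?w = "(f ^^ S (Suc k)) (f c)"
    assume "\<not> ?thesis"
    then have "(f ^^ S k) ?w \<le> (f ^^ S k) (level k)"
      unfolding k using critical_value_above[of i] hi k by (intro iter_increasing) auto
    also have "\<dots> \<le> level k" by (rule fib_nest_nice[OF fib])
    also have "(f ^^ S k) ?w = (f ^^ S (Suc (Suc k))) (f c)"
      using iter_add[of "S k" "S (Suc k)" "f c"] by (simp add: add.commute)
    finally show False using critical_value_above[of k] hi by simp
  qed
  have before: "(f ^^ j) (f c) \<le> level k" if j: "1 \<le> j" "j < S (Suc k)" for j
  proof -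
    consider "j < S k" | "j = S k" | "S k < j" by linarith
    then show ?thesis
    proof cases
      case 1
      then show ?thesis
        using fib_nest_between[OF step(1) fib _ _ j(1)] fib_nest_bounds[OF fib] by simp
    next
      case 2
      then show ?thesis using critical_value_below[of i] lo k by simp
    next
      case 3
      \<comment> \<open>Here \<open>k \<ge> 2\<close>. At time \<open>S k\<close> the value is above
        \<open>level i\<close>, and fewer than \<open>S i\<close> steps remain.\<close>
      then obtain h where h: "i = Suc h" using j k by (cases i) auto
      have fib_i: "fib_nest i" using fib' k h by simp
      have "return_level (level i) (S k) (level k)" using fib k h by (simp add: fib_nest_def)
      then have v: "level i < (f ^^ S k) (f c)" and le: "level i \<le> level k"
        using fib_nest_bounds[OF fib] unfolding return_level_def by auto
      have "(f ^^ (j - S k)) ((f ^^ S k) (f c)) \<le> level i"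
        using v f_le_max[OF iter_in[OF c_in], of "S k"] iter_Suc[of "S k" c] 3 j k h
        by (intro fib_nest_between[OF _ fib_i]) auto
      then show ?thesis using le iter_add[of "j - S k" "S k" "f c"] 3 by simp
    qed
  qed
  have fib_Suc: "fib_nest (Suc k)" by (rule fib_nest_Suc[OF step(1) fib returns before])
  have ret: "return_level (level k) (S (Suc k)) (level (Suc k))"
    by (rule fib_nest_return[OF step(1) fib_Suc])
  then have at: "(f ^^ S (Suc k)) (level (Suc k)) = level k" and less: "level (Suc k) < f c"
    and above: "\<And>v. level (Suc k) < v \<Longrightarrow> v \<le> f c \<Longrightarrow> level k < (f ^^ S (Suc k)) v"
    unfolding return_level_def by auto
  \<comment> \<open>This value is where \<open>r k\<close> arrives after \<open>S (Suc k)\<close>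
    steps, passing through \<open>f c\<close> at time \<open>S k\<close>; it places
    \<open>r k\<close> below \<open>level (Suc k)\<close>. The case \<open>i = 0\<close> is apart
    because \<open>critical_value_below\<close> starts at time \<open>S 1\<close>.\<close>
  have "(f ^^ S i) (f c) < level k"
  proof (cases i)
    case 0
    have "c < r 1" "f (r 1) = c" "r 1 < f c"
      using r_increasing[of 0] r_0 iter_r[of 1 1] r_bounds[of 1] by simp_all
    then have "f (f c) < c" using f_decreasing[of "r 1" "f c"] top by simp
    then show ?thesis using 0 lo k r_0 by simp
  next
    case (Suc h)
    then show ?thesis using critical_value_below[of h] r_increasing[of h] lo k by simp
  qed
  moreover have "(f ^^ S (Suc k)) (r k) = (f ^^ S i) (f c)"
    using iter_add[of "S i" "S k" "r k"] iter_r_max[of k] k by (simp add: add.commute)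
  ultimately have r_k: "(f ^^ S (Suc k)) (r k) < level k" by simp
  then have "r k \<le> level (Suc k)" using above[of "r k"] r_bounds[of k] by force
  moreover have "r k \<noteq> level (Suc k)" using r_k at by auto
  moreover have "level (Suc k) < r (Suc k)"
  proof (rule ccontr)
    \<comment> \<open>Then \<open>level (Suc k)\<close> is interior to an interval on which
      \<open>f ^^ S (Suc k)\<close> is monotone, but its value \<open>level k\<close> is below the
      values at both ends.\<close>
    assume not_less: "\<not> ?thesis"
    have "level (Suc k) \<noteq> r (Suc k)"
      using at iter_r_max[of "Suc k"] fib_nest_bounds[OF fib] by auto
    moreover have "inj_on (f ^^ S (Suc k)) {r (Suc k)..f c}" by (rule inj_on_r[OF S_less_Suc])
    ultimately have "(f ^^ S (Suc k)) (f c) < (f ^^ S (Suc k)) (level (Suc k))"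
      using iter_mono[of "r (Suc k)" "f c" "level (Suc k)" "S (Suc k)"] not_less less top
        r_bounds[of "Suc k"] iter_r_max[of "Suc k"] at fib_nest_bounds[OF fib] by auto
    then show False using at returns by simp
  qed
  ultimately show ?case using fib_Suc fib by simp
qed

lemma fib_nest_all: "1 \<le> k \<Longrightarrow> fib_nest k"
  using nest_interleaved by blast

lemma critical_not_in_nest:
  assumes "1 \<le> k"
  shows "(f ^^ S k) c \<notin> nest k"
proof -
  obtain i where "k = Suc i" using assms by (cases k) auto
  then show ?thesis
    using iter_mem_nest[OF fib_nest_all[OF assms] c_in, of "S k"] critical_value_below[of i]
      nest_interleaved[OF assms] by simp
qed

end

theorem mainTheorem1:
  fixes f hat :: "real \<Rightarrow> real" and c q :: real and I :: "nat \<Rightarrow> real set"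
  assumes "unimodal f c"
    and "symmetric_about c hat f"
    and "q \<in> {c<..<1}" and "f q = q"
    and "I = principal_nest f c (open_segment (hat q) q)"
  shows "fibonacci_map f c hat \<longleftrightarrow>
    (\<forall>k\<ge>1. \<exists>I\<^sub>0 I\<^sub>1.
       ({C \<in> return_domains f (I k). C \<inter> forward_orbit f c \<noteq> {}} = {I\<^sub>0, I\<^sub>1} \<and> I\<^sub>0 \<noteq> I\<^sub>1 \<and>
        I\<^sub>0 = I (k + 1)) \<and>
       ((\<forall>x\<in>I\<^sub>0. first_entry f (I k) x = (f ^^ S (k + 1)) x) \<and>
        (\<forall>x\<in>I\<^sub>1. first_entry f (I k) x = (f ^^ S k) x)) \<and>
       (f ^^ S k) c \<notin> I k)"
proof -
  interpret symmetric_unimodal f hat c q by unfold_locales (use assms in auto)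
  have I: "I = nest" using assms by (simp add: nest_def)
  show ?thesis
  proof
    assume "fibonacci_map f c hat"
    then obtain p T where near: "\<And>k. nearest_preimage f c k (p k)"
      and T: "closest_times p hat T" "\<And>i. T i = S i"
      unfolding fibonacci_map_def by blast
    have "T = S" using T(2) by blast
    with T(1) interpret fibonacci_preimages f hat c q p
      unfolding closest_times_iff[OF near] by unfold_locales (use near in auto)
    show "\<forall>k\<ge>1. \<exists>I\<^sub>0 I\<^sub>1.
       ({C \<in> return_domains f (I k). C \<inter> forward_orbit f c \<noteq> {}} = {I\<^sub>0, I\<^sub>1} \<and> I\<^sub>0 \<noteq> I\<^sub>1 \<and>
        I\<^sub>0 = I (k + 1)) \<and>
       ((\<forall>x\<in>I\<^sub>0. first_entry f (I k) x = (f ^^ S (k + 1)) x) \<and>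
        (\<forall>x\<in>I\<^sub>1. first_entry f (I k) x = (f ^^ S k) x)) \<and>
       (f ^^ S k) c \<notin> I k"
      unfolding I
      using fib_nest_imp_return_structure[OF fib_nest_all critical_not_in_nest] by blast
  next
    assume props: "\<forall>k\<ge>1. \<exists>I\<^sub>0 I\<^sub>1.
       ({C \<in> return_domains f (I k). C \<inter> forward_orbit f c \<noteq> {}} = {I\<^sub>0, I\<^sub>1} \<and> I\<^sub>0 \<noteq> I\<^sub>1 \<and>
        I\<^sub>0 = I (k + 1)) \<and>
       ((\<forall>x\<in>I\<^sub>0. first_entry f (I k) x = (f ^^ S (k + 1)) x) \<and>
        (\<forall>x\<in>I\<^sub>1. first_entry f (I k) x = (f ^^ S k) x)) \<and>
       (f ^^ S k) c \<notin> I k"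
    have "nest (Suc k) \<in> return_domains f (nest k) \<and>
        (\<forall>x\<in>nest (Suc k). first_entry f (nest k) x = (f ^^ S (Suc k)) x) \<and>
        (f ^^ S k) c \<notin> nest k" if "1 \<le> k" for k
      using props[rule_format, OF that] unfolding I Suc_eq_plus1 by blast
    then show "fibonacci_map f c hat"
      using return_structure_imp_fib_nest fib_nest_imp_fibonacci_map by blast
  qed
qed

end
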